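(* Let $E$ be a separable Banach space and let $\mathcal{X}$ be a decomposable normed subspace of $L_0(\Omega,E)$ such that there exists an increasing covering $(\Omega_n)_n$ of $\Omega$ by measurable sets with $\{y1_{\Omega_n}: y\in L_\infty(\Omega,E)\}\subset\mathcal{X}$ for every $n$. Let $f:\Omega\times E\to\overline{\mathbb{R}}$ be a measurable integrand, let $\mathcal{B}$ be an integral bornology on $\mathcal{X}$ associated to a family $\{\phi_i: i\in I\}$ of non negative integrands, let $x_0\in\mathcal{X}$ with $I_f(x_0)$ finite, and let $x^*\in\mathcal{X}^*\cap L_0(\Omega,E^*_{\sigma^*})$. Consider the assertions: (a) $x^*$ is a $\mathcal{B}$-subderivative of $I_f$ at $x_0$; (b) for every $i\in I$ and every $\epsilon>0$ there exists a family $\{u_r: r\in(0,1)\}$ of non negative functions, integrable for all sufficiently small $r$, with $\|u_r\|_1\to0$ as $r\to0_+$, such that for all sufficiently small $r>0$ $$[f-\langle x^*,\cdot\rangle](x_0,\cdot,r)\ \ge\ -\epsilon\,\phi_i-u_r .$$ Then always (b) $\Rightarrow$ (a). If in addition the measure $\mu$ is atomless, then (a) and (b) are equivalent.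
   Context: $(\Omega,\mathbb{T},\mu)$ is a measure space with $\mu$ a $\sigma$-finite positive measure and $\mathbb{T}$ $\mu$-complete. $L_0(\Omega,E)$ is the space of classes (a.e. equality) of measurable functions $\Omega\to E$. An integrand is any function $\Omega\times E\to\overline{\mathbb{R}}$; it is called measurable if it is $\mathbb{T}\otimes\mathcal{B}(E)$-measurable, where $\mathcal{B}(E)$ is the Borel tribe of $E$. For an integrand $g$, $I_g(x)=\int^*_\Omega g(\omega,x(\omega))\,d\mu(\omega)$ with the upper integral $\int^*_\Omega v\,d\mu=\inf\{\int_\Omega u\,d\mu: u\in L_1(\Omega,\mathbb{R}),\ u\ge v\text{ a.e.}\}$. For integrands, $g\ge h$ means that there is a negligible set $N$ with $g(\omega,e)\ge h(\omega,e)$ for all $\omega\notin N$, $e\in E$. $\mathcal{X}$ is decomposable if $x1_A+y1_{A^c}\in\mathcal{X}$ for all $x,y\in\mathcal{X}$, $A\in\mathbb{T}$. $x^*\in\mathcal{X}^*\cap L_0(\Omega,E^*_{\sigma^*})$ means that $x^*:\Omega\to E^*$ is scalarly measurable and $x\mapsto\int_\Omega\langle x^*,x\rangle\,d\mu$ is a well-defined continuous linear functional on $\mathcal{X}$. $[f-\langle x^*,\cdot\rangle](x_0,\cdot,r)$ is the integrand $(\omega,e)\mapsto r^{-1}(f(\omega,x_0(\omega)+re)-f(\omega,x_0(\omega)))-\langle x^*(\omega),e\rangle$. For a functional $J$ on $\mathcal{X}$ finite at $x_0$, $[J](x_0,x,r)=r^{-1}(J(x_0+rx)-J(x_0))$.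 A bornology on $\mathcal{X}$ is a hereditary family $\mathcal{B}$ of subsets of $\mathcal{X}$, stable under finite unions, covering $\mathcal{X}$. It is an integral bornology associated to a family $\{\phi_i: i\in I\}$ of non negative integrands with $\phi_i(\cdot,0)=0$ for all $i$ if $\mathcal{B}$ is exactly the family of sets $B\subset\mathcal{X}$ contained in some sublevel set $\{x\in\mathcal{X}: I_{\phi_i}(x)\le s\}$, $i\in I$, $s\in\mathbb{R}$. For $J$ finite at $x_0$, $x^*\in\mathcal{X}^*$ is a $\mathcal{B}$-subderivative of $J$ at $x_0$ if for every $X\in\mathcal{B}$, $\liminf_{r\to0_+}\inf_{x\in X}([J](x_0,x,r)-\langle x^*,x\rangle)\ge0$.
   Formalization: In the atomless equivalence, the implication (a) ⇒ (b) is proved for measurable integrands φ_i; for arbitrary non-measurable non-negative integrands it is false. The implication (b) ⇒ (a) is proved for arbitrary φ_i as stated. *)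

theory Defs
  imports "HOL-Analysis.Analysis"
begin

text \<open>
  Throughout, the type of \<open>E\<close> is of class \<open>banach\<close> and \<open>second_countable_topology\<close>, i.e. a separable
  Banach space. Elements of \<open>L\<^sub>0(\<Omega>,E)\<close> are represented by Borel measurable functions; a subspace of
  \<open>L\<^sub>0(\<Omega>,E)\<close> is represented by a set of functions that is saturated for almost everywhere equality.
\<close>

definition normed_subspace_L0 ::
    "'w measure \<Rightarrow> ('w \<Rightarrow> 'e::{banach, second_countable_topology}) set \<Rightarrow> (('w \<Rightarrow> 'e) \<Rightarrow> real) \<Rightarrow> bool" where
  "normed_subspace_L0 M X N \<longleftrightarrow>
     X \<subseteq> borel_measurable M \<and>
     (\<forall>x\<in>X. \<forall>y\<in>borel_measurable M. (AE w in M. x w = y w) \<longrightarrow> y \<in> X) \<and>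
     (\<lambda>w. 0) \<in> X \<and>
     (\<forall>x\<in>X. \<forall>y\<in>X. (\<lambda>w. x w + y w) \<in> X) \<and>
     (\<forall>c. \<forall>x\<in>X. (\<lambda>w. c *\<^sub>R x w) \<in> X) \<and>
     (\<forall>x\<in>X. 0 \<le> N x) \<and>
     (\<forall>x\<in>X. N x = 0 \<longleftrightarrow> (AE w in M. x w = 0)) \<and>
     (\<forall>c. \<forall>x\<in>X. N (\<lambda>w. c *\<^sub>R x w) = \<bar>c\<bar> * N x) \<and>
     (\<forall>x\<in>X. \<forall>y\<in>X. N (\<lambda>w. x w + y w) \<le> N x + N y)"

definition decomposable :: "'w measure \<Rightarrow> ('w \<Rightarrow> 'e) set \<Rightarrow> bool" where
  "decomposable M X \<longleftrightarrow>
     (\<forall>x\<in>X. \<forall>y\<in>X. \<forall>A\<in>sets M. (\<lambda>w. if w \<in> A then x w else y w) \<in> X)"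

definition Linfty :: "'w measure \<Rightarrow> ('w \<Rightarrow> 'e::{banach, second_countable_topology}) set" where
  "Linfty M = {y \<in> borel_measurable M. \<exists>C. AE w in M. norm (y w) \<le> C}"

definition in_dual :: "('w \<Rightarrow> 'e::real_vector) set \<Rightarrow> (('w \<Rightarrow> 'e) \<Rightarrow> real) \<Rightarrow> (('w \<Rightarrow> 'e) \<Rightarrow> real) \<Rightarrow> bool" where
  "in_dual X N l \<longleftrightarrow>
     (\<forall>x\<in>X. \<forall>y\<in>X. l (\<lambda>w. x w + y w) = l x + l y) \<and>
     (\<forall>c. \<forall>x\<in>X. l (\<lambda>w. c *\<^sub>R x w) = c * l x) \<and>
     (\<exists>C. \<forall>x\<in>X. \<bar>l x\<bar> \<le> C * N x)"

definition pairing :: "'w measure \<Rightarrow> ('w \<Rightarrow> ('e::real_normed_vector \<Rightarrow>\<^sub>L real)) \<Rightarrow> ('w \<Rightarrow> 'e) \<Rightarrow> real" where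
  "pairing M xs x = (LINT w|M. blinfun_apply (xs w) (x w))"

definition dual_L0 :: "'w measure \<Rightarrow> ('w \<Rightarrow> 'e::real_normed_vector) set \<Rightarrow> (('w \<Rightarrow> 'e) \<Rightarrow> real)
    \<Rightarrow> ('w \<Rightarrow> ('e \<Rightarrow>\<^sub>L real)) \<Rightarrow> bool" where
  "dual_L0 M X N xs \<longleftrightarrow>
     (\<forall>e. (\<lambda>w. blinfun_apply (xs w) e) \<in> borel_measurable M) \<and>
     (\<forall>x\<in>X. integrable M (\<lambda>w. blinfun_apply (xs w) (x w))) \<and>
     in_dual X N (pairing M xs)"

definition atom :: "'w measure \<Rightarrow> 'w set \<Rightarrow> bool" where
  "atom M A \<longleftrightarrow> A \<in> sets M \<and> emeasure M A > 0 \<and>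
     (\<forall>B\<in>sets M. B \<subseteq> A \<longrightarrow> emeasure M B = 0 \<or> emeasure M (A - B) = 0)"

definition atomless :: "'w measure \<Rightarrow> bool" where
  "atomless M \<longleftrightarrow> (\<nexists>A. atom M A)"

definition upper_integral :: "'w measure \<Rightarrow> ('w \<Rightarrow> ereal) \<Rightarrow> ereal" where
  "upper_integral M v =
     (INF u \<in> {u :: 'w \<Rightarrow> real. integrable M u \<and> (AE w in M. v w \<le> ereal (u w))}.
        ereal (integral\<^sup>L M u))"

definition measurable_integrand :: "'w measure \<Rightarrow> ('w \<Rightarrow> 'e::topological_space \<Rightarrow> ereal) \<Rightarrow> bool" where
  "measurable_integrand M f \<longleftrightarrow> (\<lambda>(w, e). f w e) \<in> borel_measurable (M \<Otimes>\<^sub>M borel)"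

definition integral_functional :: "'w measure \<Rightarrow> ('w \<Rightarrow> 'e \<Rightarrow> ereal) \<Rightarrow> ('w \<Rightarrow> 'e) \<Rightarrow> ereal" where
  "integral_functional M g x = upper_integral M (\<lambda>w. g w (x w))"

definition integrand_ge ::
    "'w measure \<Rightarrow> ('w \<Rightarrow> 'e \<Rightarrow> ereal) \<Rightarrow> ('w \<Rightarrow> 'e \<Rightarrow> ereal) \<Rightarrow> bool" where
  "integrand_ge M g h \<longleftrightarrow> (\<exists>Z\<in>null_sets M. \<forall>w\<in>space M - Z. \<forall>e. g w e \<ge> h w e)"

text \<open>
  In both difference quotients the subtracted value is finite wherever it matters: \<open>J x0\<close> is finite,
  and finiteness of the upper integral of the measurable function \<open>w \<mapsto> f w (x0 w)\<close> makes that
  function finite almost everywhere.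
\<close>

definition quotient_integrand :: "('w \<Rightarrow> 'e::real_normed_vector \<Rightarrow> ereal) \<Rightarrow> ('w \<Rightarrow> ('e \<Rightarrow>\<^sub>L real))
    \<Rightarrow> ('w \<Rightarrow> 'e) \<Rightarrow> real \<Rightarrow> 'w \<Rightarrow> 'e \<Rightarrow> ereal" where
  "quotient_integrand f xs x0 r =
     (\<lambda>w e. ereal (inverse r) * (f w (x0 w + r *\<^sub>R e) - f w (x0 w)) - ereal (blinfun_apply (xs w) e))"

definition quotient_functional :: "(('w \<Rightarrow> 'e::real_vector) \<Rightarrow> ereal) \<Rightarrow> ('w \<Rightarrow> 'e) \<Rightarrow> ('w \<Rightarrow> 'e)
    \<Rightarrow> real \<Rightarrow> ereal" where
  "quotient_functional J x0 x r = ereal (inverse r) * (J (\<lambda>w. x0 w + r *\<^sub>R x w) - J x0)"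

definition bornology :: "'a set \<Rightarrow> 'a set set \<Rightarrow> bool" where
  "bornology X \<B> \<longleftrightarrow>
     \<B> \<subseteq> Pow X \<and>
     (\<forall>B\<in>\<B>. \<forall>C. C \<subseteq> B \<longrightarrow> C \<in> \<B>) \<and>
     (\<forall>B\<in>\<B>. \<forall>C\<in>\<B>. B \<union> C \<in> \<B>) \<and>
     \<Union>\<B> = X"

definition integral_bornology :: "'w measure \<Rightarrow> ('w \<Rightarrow> 'e::real_vector) set \<Rightarrow> 'i set
    \<Rightarrow> ('i \<Rightarrow> 'w \<Rightarrow> 'e \<Rightarrow> ereal) \<Rightarrow> ('w \<Rightarrow> 'e) set set \<Rightarrow> bool" where
  "integral_bornology M X I \<phi> \<B> \<longleftrightarrow>
     bornology X \<B> \<and>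
     (\<forall>i\<in>I. \<forall>w\<in>space M. (\<forall>e. 0 \<le> \<phi> i w e) \<and> \<phi> i w 0 = 0) \<and>
     \<B> = {B. \<exists>i\<in>I. \<exists>s::real. B \<subseteq> {x\<in>X. integral_functional M (\<phi> i) x \<le> ereal s}}"

definition subderivative :: "('w \<Rightarrow> 'e::real_vector) set \<Rightarrow> (('w \<Rightarrow> 'e) \<Rightarrow> real) \<Rightarrow> ('w \<Rightarrow> 'e) set set
    \<Rightarrow> (('w \<Rightarrow> 'e) \<Rightarrow> ereal) \<Rightarrow> ('w \<Rightarrow> 'e) \<Rightarrow> (('w \<Rightarrow> 'e) \<Rightarrow> real) \<Rightarrow> bool" where
  "subderivative X N \<B> J x0 l \<longleftrightarrow>
     in_dual X N l \<and>
     (\<forall>B\<in>\<B>. Liminf (at_right 0) (\<lambda>r. INF x\<in>B. quotient_functional J x0 x r - ereal (l x)) \<ge> 0)"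

definition integrand_minorization :: "'w measure \<Rightarrow> 'i set
    \<Rightarrow> ('i \<Rightarrow> 'w \<Rightarrow> 'e::real_normed_vector \<Rightarrow> ereal) \<Rightarrow> ('w \<Rightarrow> 'e \<Rightarrow> ereal)
    \<Rightarrow> ('w \<Rightarrow> ('e \<Rightarrow>\<^sub>L real)) \<Rightarrow> ('w \<Rightarrow> 'e) \<Rightarrow> bool" where
  "integrand_minorization M I \<phi> f xs x0 \<longleftrightarrow>
     (\<forall>i\<in>I. \<forall>\<epsilon>>0::real. \<exists>u :: real \<Rightarrow> 'w \<Rightarrow> real.
        (\<forall>r\<in>{0<..<1}. \<forall>w\<in>space M. 0 \<le> u r w) \<and>
        (\<forall>\<^sub>F r in at_right 0. integrable M (u r)) \<and>
        ((\<lambda>r. LINT w|M. \<bar>u r w\<bar>) \<longlongrightarrow> 0) (at_right 0) \<and>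
        (\<forall>\<^sub>F r in at_right 0.
           integrand_ge M (quotient_integrand f xs x0 r)
             (\<lambda>w e. - ereal \<epsilon> * \<phi> i w e - ereal (u r w))))"

end

theory Submission
  imports Defs
begin

text \<open>
  Why the theorem is true. The functional \<open>I\<^sub>f\<close> is finite at \<open>x\<^sub>0\<close>, so \<open>f(\<cdot>, x\<^sub>0)\<close> is integrable, and
  subtracting integrable quantities commutes with the upper integral. Hence the difference quotient of
  \<open>I\<^sub>f\<close> minus the pairing with \<open>x\<^sup>*\<close> is the integral functional of the integrand
  \<open>g\<^sub>r = [f - x\<^sup>*](x\<^sub>0, \<cdot>, r)\<close>; this is \<open>integral_functional_quotient_integrand\<close>. The question is
  therefore when \<open>I\<close> of \<open>g\<^sub>r\<close> is asymptotically nonnegative, uniformly on sublevel sets of \<open>I\<^sub>\<phi>\<close>.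

  If \<open>g\<^sub>r \<ge> - \<epsilon> \<phi> - u\<^sub>r\<close>, integration gives the lower bound \<open>- \<epsilon> s - \<parallel>u\<^sub>r\<parallel>\<^sub>1\<close> on \<open>{I\<^sub>\<phi> \<le> s}\<close>, and
  \<open>\<epsilon>\<close> is arbitrary.

  For the converse the candidate is the smallest possible \<open>u\<^sub>r\<close>, the supremum over \<open>e\<close> of
  \<open>- \<epsilon> \<phi>(\<omega>, e) - g\<^sub>r(\<omega>, e)\<close>, and two things have to be shown.

  First, its integral tends to \<open>0\<close>. Suppose that along some measurable selection \<open>x\<close> the positive part
  of \<open>- \<epsilon> \<phi> - g\<^sub>r\<close> has integral above \<open>\<delta>\<close>. After truncation, \<open>x\<close> lies in the space. If its integral
  of \<open>\<phi>\<close> is at most \<open>1\<close>, then \<open>g\<^sub>r\<close> has integral below \<open>- \<delta>\<close> along it. Otherwise, as there are no atoms, \<open>x\<close> can be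
  restricted to a set on which \<open>\<phi>\<close> has integral exactly \<open>1\<close>, and \<open>g\<^sub>r\<close> has integral at most \<open>- \<epsilon>\<close> along the
  restriction. Both contradict the subderivative inequality on \<open>{I\<^sub>\<phi> \<le> 1}\<close> for small \<open>r\<close>; this is
  \<open>deficits_nn_integral_le\<close>.

  Second, the supremum over \<open>e\<close> has to be controlled by measurable selections. The essential supremum over
  selections bounds each selection almost everywhere, with an exceptional set depending on the
  selection. That the inequality holds outside one null set for all \<open>e\<close> is the measurable selection
  theorem \<open>AE_sections_empty_if_no_selection\<close>. Its proof represents a product-measurable set as the projection of a
  closed set in a Polish fibre and runs Choquet's capacity argument for the outer measure.
\<close>

section \<open>Borel sets as projections of closed sets\<close>

text \<open>
  The Souslin sets of a metric space, in projective form. The auxiliary sequence is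
  real-valued, which makes it range over a countable power of a complete separable metric space; integrality of a
  coordinate is a closed condition and can be imposed where it is wanted.
\<close>

definition souslin :: "'a::topological_space set \<Rightarrow> bool" where
  "souslin B \<longleftrightarrow> (\<exists>C :: ('a \<times> (nat \<Rightarrow> real)) set. closed C \<and> B = {p. \<exists>\<sigma>. (p, \<sigma>) \<in> C})"

lemma souslin_closed: "closed F \<Longrightarrow> souslin F"
  unfolding souslin_def by (intro exI[of _ "F \<times> UNIV"]) (auto intro: closed_Times)

lemma continuous_on_snd_coordinate:
  "continuous_on UNIV (\<lambda>q :: 'a::topological_space \<times> ('b \<Rightarrow> 'c::topological_space). snd q k)"
  by (rule continuous_on_compose2[OF continuous_on_product_coordinates continuous_on_snd]) auto

lemma souslin_UN:
  fixes B :: "nat \<Rightarrow> 'a::topological_space set"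
  assumes "\<And>n. souslin (B n)"
  shows "souslin (\<Union>n. B n)"
proof -
  obtain C :: "nat \<Rightarrow> ('a \<times> (nat \<Rightarrow> real)) set"
    where C: "\<And>n. closed (C n)" "\<And>n. B n = {p. \<exists>\<sigma>. (p, \<sigma>) \<in> C n}"
    using assms unfolding souslin_def by metis
  \<comment> \<open>The zeroth coordinate names the index of the union. A union over that index would not obviously
    be closed; for integral values it equals the following intersection of unions of two closed sets.\<close>
  define D where "D = {q :: 'a \<times> (nat \<Rightarrow> real). snd q 0 \<in> \<int>}
    \<inter> {q. 0 \<le> snd q 0}
    \<inter> (\<Inter>n. {q. 1 \<le> \<bar>snd q 0 - real n\<bar>} \<union> (\<lambda>q. (fst q, \<lambda>k. snd q (Suc k))) -` C n)"
  have "closed ((\<lambda>q :: 'a \<times> (nat \<Rightarrow> real). snd q 0) -` \<int>)"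
    by (intro closed_vimage closed_Ints continuous_on_snd_coordinate)
  moreover have "closed {q :: 'a \<times> (nat \<Rightarrow> real). 0 \<le> snd q 0}"
    by (intro closed_Collect_le continuous_on_snd_coordinate continuous_intros)
  moreover have "closed {q :: 'a \<times> (nat \<Rightarrow> real). 1 \<le> \<bar>snd q 0 - real n\<bar>}" for n
    by (intro closed_Collect_le continuous_on_snd_coordinate continuous_intros)
  moreover have "closed ((\<lambda>q :: 'a \<times> (nat \<Rightarrow> real). (fst q, \<lambda>k. snd q (Suc k))) -` C n)" for n
    by (intro closed_vimage C continuous_intros continuous_on_snd_coordinate)
  ultimately have "closed D"
    unfolding D_def vimage_def by (intro closed_Int closed_INT closed_Un ballI) auto
  moreover have "(\<Union>n. B n) = {p. \<exists>\<sigma>. (p, \<sigma>) \<in> D}"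
  proof (intro set_eqI iffI)
    fix p assume "p \<in> (\<Union>n. B n)"
    then obtain n \<sigma> where n: "(p, \<sigma>) \<in> C n" using C(2) by auto
    have "(p, case_nat (real n) \<sigma>) \<in> D"
    proof -
      have "1 \<le> \<bar>real n - real m\<bar> \<or> (p, \<sigma>) \<in> C m" for m
        using n by (cases "m = n") auto
      then show ?thesis unfolding D_def by auto
    qed
    then show "p \<in> {p. \<exists>\<sigma>. (p, \<sigma>) \<in> D}" by blast
  next
    fix p assume "p \<in> {p. \<exists>\<sigma>. (p, \<sigma>) \<in> D}"
    then obtain \<sigma> where \<sigma>: "(p, \<sigma>) \<in> D" by blast
    then obtain z :: int where z: "\<sigma> 0 = of_int z" "0 \<le> \<sigma> 0" unfolding D_def by (auto elim!: Ints_cases)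
    then have "\<sigma> 0 = real (nat z)" by simp
    moreover have "1 \<le> \<bar>\<sigma> 0 - real (nat z)\<bar> \<or> (p, \<lambda>k. \<sigma> (Suc k)) \<in> C (nat z)"
      using \<sigma> unfolding D_def by auto
    ultimately have "(p, \<lambda>k. \<sigma> (Suc k)) \<in> C (nat z)" by simp
    then show "p \<in> (\<Union>n. B n)" using C(2) by auto
  qed
  ultimately show ?thesis unfolding souslin_def by blast
qed

lemma souslin_INT:
  fixes B :: "nat \<Rightarrow> 'a::topological_space set"
  assumes "\<And>n. souslin (B n)"
  shows "souslin (\<Inter>n. B n)"
proof -
  obtain C :: "nat \<Rightarrow> ('a \<times> (nat \<Rightarrow> real)) set"
    where C: "\<And>n. closed (C n)" "\<And>n. B n = {p. \<exists>\<sigma>. (p, \<sigma>) \<in> C n}"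
    using assms unfolding souslin_def by metis
  define D where "D = (\<Inter>n. (\<lambda>q. (fst q, \<lambda>k. snd q (prod_encode (n, k)))) -` C n)"
  have "closed D"
    unfolding D_def
    by (intro closed_INT ballI closed_vimage C continuous_intros continuous_on_snd_coordinate)
  moreover have "(\<Inter>n. B n) = {p. \<exists>\<sigma>. (p, \<sigma>) \<in> D}"
  proof (intro set_eqI iffI)
    fix p assume "p \<in> (\<Inter>n. B n)"
    then obtain \<tau> where "\<And>n. (p, \<tau> n) \<in> C n" using C(2) by simp metis
    then have "(p, \<lambda>m. case prod_decode m of (n, k) \<Rightarrow> \<tau> n k) \<in> D"
      unfolding D_def by simp
    then show "p \<in> {p. \<exists>\<sigma>. (p, \<sigma>) \<in> D}" by blast
  next
    fix p assume "p \<in> {p. \<exists>\<sigma>. (p, \<sigma>) \<in> D}"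
    then show "p \<in> (\<Inter>n. B n)" unfolding D_def C(2) by auto
  qed
  ultimately show ?thesis unfolding souslin_def by blast
qed

text \<open>
  Souslin sets need not have Souslin complements, but those that do form a \<open>\<sigma>\<close>-algebra, and in a
  metric space it contains the open sets, these being countable unions of closed sets.
\<close>

lemma souslin_borel:
  fixes B :: "'a::metric_space set"
  assumes "B \<in> sets borel"
  shows "souslin B"
proof -
  have "B \<in> sigma_sets UNIV {S. open S}"
    using assms by (simp add: borel_def)
  then have "souslin B \<and> souslin (- B)"
  proof induction
    case (Basic U)
    then have "fsigma_in euclidean U"
      by (intro open_imp_fsigma_in metrizable_space_euclidean) auto
    then obtain F :: "nat \<Rightarrow> 'a set" where F: "\<And>n. closed (F n)" "\<Union>(range F) = U"
      unfolding fsigma_in_ascending by auto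
    have "souslin (\<Union>n. F n)"
      by (intro souslin_UN souslin_closed F)
    then show ?case using F(2) Basic by (auto intro: souslin_closed)
  next
    case Empty
    show ?case by (simp add: souslin_closed)
  next
    case (Compl a)
    then show ?case by (simp add: Compl_eq_Diff_UNIV[symmetric])
  next
    case (Union a)
    have "souslin (\<Inter>n. - a n)" using Union by (intro souslin_INT) auto
    with Union show ?case by (auto intro: souslin_UN)
  qed
  then show ?thesis ..
qed

text \<open>
  Only countably many rectangles enter the construction of a product-measurable set, so their
  \<open>\<Omega>\<close>-sides can be recorded as one measurable map into a sequence space. This replaces the
  unstructured space \<open>\<Omega>\<close> by a metric space.
\<close>

lemma product_measurable_eq_vimage_borel:
  fixes G :: "('w \<times> 'e::second_countable_topology) set"
  assumes "G \<in> sets (M \<Otimes>\<^sub>M borel)"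
  obtains h :: "'w \<Rightarrow> nat \<Rightarrow> real" and B where "h \<in> borel_measurable M" "B \<in> sets borel"
    "G = {(w, e). w \<in> space M \<and> (h w, e) \<in> B}"
proof -
  have *: "G \<in> sigma_sets (space M \<times> space borel)
      {a \<times> b |a b. a \<in> sets M \<and> b \<in> sets (borel :: 'e measure)}"
    using assms by (simp add: sets_pair_measure)
  define R where "R G h B \<longleftrightarrow> h \<in> borel_measurable M \<and> B \<in> sets borel
    \<and> G = {(w, e). w \<in> space M \<and> (h w, e) \<in> B}"
    for G :: "('w \<times> 'e) set" and h :: "'w \<Rightarrow> nat \<Rightarrow> real" and B
  from * have "\<exists>h B. R G h B"
  proof induction
    case (Basic G)
    then obtain a b where G: "G = a \<times> b" "a \<in> sets M" "b \<in> sets (borel :: 'e measure)" by auto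
    define h :: "'w \<Rightarrow> nat \<Rightarrow> real" where "h = (\<lambda>w k. indicator a w)"
    have "h \<in> borel_measurable M"
      unfolding h_def using G by (intro measurable_coordinatewise_then_product) auto
    moreover have "closed ((\<lambda>t :: nat \<Rightarrow> real. t 0) -` {1})"
      by (intro closed_vimage) auto
    then have "((\<lambda>t :: nat \<Rightarrow> real. t 0) -` {1}) \<times> b \<in> sets (borel \<Otimes>\<^sub>M borel)"
      using G(3) by (intro pair_measureI[OF borel_closed])
    then have "((\<lambda>t :: nat \<Rightarrow> real. t 0) -` {1}) \<times> b \<in> sets borel"
      unfolding borel_prod .
    moreover have "G = {(w, e). w \<in> space M \<and> (h w, e) \<in> ((\<lambda>t :: nat \<Rightarrow> real. t 0) -` {1}) \<times> b}"
      using G sets.sets_into_space[OF G(2)] by (auto simp: h_def indicator_eq_1_iff)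
    ultimately show ?case unfolding R_def by blast
  next
    case Empty
    show ?case unfolding R_def by (intro exI[of _ "\<lambda>_ _. 0"] exI[of _ "{}"]) auto
  next
    case (Compl G)
    then obtain h :: "'w \<Rightarrow> nat \<Rightarrow> real" and B where "h \<in> borel_measurable M" "B \<in> sets borel"
      "G = {(w, e). w \<in> space M \<and> (h w, e) \<in> B}" unfolding R_def by auto
    then have "R (space M \<times> space borel - G) h (- B)"
      unfolding R_def by (auto intro: borel_comp)
    then show ?case by blast
  next
    case (Union G)
    then obtain h B where R: "\<And>n. R (G n) (h n) (B n)" by metis
    then have h: "\<And>n. h n \<in> borel_measurable M" and B: "\<And>n. B n \<in> sets borel"
      and G: "\<And>n. G n = {(w, e). w \<in> space M \<and> (h n w, e) \<in> B n}" unfolding R_def by auto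
    define k :: "'w \<Rightarrow> nat \<Rightarrow> real" where "k = (\<lambda>w m. case prod_decode m of (n, i) \<Rightarrow> h n w i)"
    have "k \<in> borel_measurable M"
      unfolding k_def
      using measurable_compose[OF h borel_measurable_continuous_onI[OF continuous_on_product_coordinates]]
      by (intro measurable_coordinatewise_then_product) (auto split: prod.split)
    moreover
    define p where "p = (\<lambda>n (q :: (nat \<Rightarrow> real) \<times> 'e). (\<lambda>i. fst q (prod_encode (n, i)), snd q))"
    have "p n \<in> borel_measurable borel" for n
      unfolding p_def
      by (intro borel_measurable_continuous_onI continuous_intros
          continuous_on_compose2[OF continuous_on_product_coordinates continuous_on_fst]) auto
    then have "p n -` B n \<inter> space borel \<in> sets borel" for n
      using B by (rule measurable_sets)
    then have "(\<Union>n. p n -` B n) \<in> sets borel" by auto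
    moreover have "\<Union>(range G) = {(w, e). w \<in> space M \<and> (k w, e) \<in> (\<Union>n. p n -` B n)}"
      by (auto simp: G p_def k_def)
    ultimately show ?case unfolding R_def by blast
  qed
  then show ?thesis using that unfolding R_def by blast
qed

section \<open>Measurable selection on sets of positive measure\<close>

lemma closed_totally_bounded_range_cluster:
  fixes y :: "nat \<Rightarrow> 'y::complete_space"
  assumes K: "decseq K" "\<And>n. \<exists>F. finite F \<and> K n \<subseteq> (\<Union>d\<in>F. cball d ((1/2)^n))"
    and y: "\<And>n. y n \<in> K n"
  obtains l r where "strict_mono (r :: nat \<Rightarrow> nat)" "(y \<circ> r) \<longlonglongrightarrow> l"
proof -
  have "compact (closure (range y))"
    unfolding compact_eq_totally_bounded
  proof (intro conjI allI impI)
    show "complete (closure (range y))"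
      by (simp add: complete_eq_closed)
    fix \<epsilon> :: real assume "0 < \<epsilon>"
    then obtain m where m: "(1/2 :: real)^m < \<epsilon> / 2"
      using real_arch_pow_inv[of "\<epsilon>/2" "1/2"] by auto
    obtain F where F: "finite F" "K m \<subseteq> (\<Union>d\<in>F. cball d ((1/2)^m))" using K(2) by blast
    let ?U = "\<Union>d\<in>F \<union> y ` {..<m}. cball d ((1/2)^m)"
    have "range y \<subseteq> ?U"
    proof safe
      fix n show "y n \<in> ?U"
      proof (cases "n < m")
        case True
        then show ?thesis by (intro UN_I[of "y n"]) auto
      next
        case False
        then have "y n \<in> K m" using y[of n] decseqD[OF K(1), of m n] by auto
        then have "y n \<in> (\<Union>d\<in>F. cball d ((1/2)^m))" using F(2) by (rule subsetD[rotated])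
        then show ?thesis by (simp only: UN_Un Un_iff simp_thms)
      qed
    qed
    moreover have "closed ?U" using F(1) by (intro closed_UN) auto
    ultimately have "closure (range y) \<subseteq> ?U" by (rule closure_minimal)
    also have "\<dots> \<subseteq> (\<Union>d\<in>F \<union> y ` {..<m}. ball d \<epsilon>)"
      using m \<open>0 < \<epsilon>\<close> by (intro UN_mono[OF order_refl]) (auto simp: subset_eq)
    finally show "\<exists>k. finite k \<and> closure (range y) \<subseteq> (\<Union>x\<in>k. ball x \<epsilon>)"
      using F(1) by (intro exI[of _ "F \<union> y ` {..<m}"]) auto
  qed
  then have "seq_compact (closure (range y))" by (rule compact_imp_seq_compact)
  moreover have "\<forall>n. y n \<in> closure (range y)" using closure_subset[of "range y"] by auto
  ultimately show ?thesis using that by (rule seq_compactE)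
qed

text \<open>
  The projections of the sections of \<open>C\<close> over a shrinking, ever more totally bounded \<open>K n\<close> may fail to
  be measurable, but in the limit they may be replaced by their closures: points \<open>t\<^sub>n \<rightarrow> t\<close> in
  the projections lift to points of \<open>C\<close> whose second components cluster.
\<close>

lemma INT_closure_projection:
  fixes C :: "('t::metric_space \<times> 'y::complete_space) set"
  assumes C: "closed C" and K: "\<And>n. closed (K n)" "decseq K"
    "\<And>n. \<exists>F. finite F \<and> K n \<subseteq> (\<Union>d\<in>F. cball d ((1/2)^n))"
  shows "(\<Inter>n. closure {t. \<exists>y\<in>K n. (t, y) \<in> C}) = {t. \<exists>y\<in>(\<Inter>n. K n). (t, y) \<in> C}"
proof
  show "{t. \<exists>y\<in>(\<Inter>n. K n). (t, y) \<in> C} \<subseteq> (\<Inter>n. closure {t. \<exists>y\<in>K n. (t, y) \<in> C})"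
    by (intro INT_greatest order_trans[OF _ closure_subset]) auto
  show "(\<Inter>n. closure {t. \<exists>y\<in>K n. (t, y) \<in> C}) \<subseteq> {t. \<exists>y\<in>(\<Inter>n. K n). (t, y) \<in> C}"
  proof
    fix t assume t: "t \<in> (\<Inter>n. closure {t. \<exists>y\<in>K n. (t, y) \<in> C})"
    have "\<exists>t' y. dist t' t < (1/2)^n \<and> y \<in> K n \<and> (t', y) \<in> C" for n
    proof -
      have "t \<in> closure {t. \<exists>y\<in>K n. (t, y) \<in> C}" using t by blast
      then have "\<exists>t'\<in>{t. \<exists>y\<in>K n. (t, y) \<in> C}. dist t' t < (1/2)^n"
        unfolding closure_approachable by simp
      then show ?thesis by blast
    qed
    then obtain s y where s: "\<And>n. dist (s n) t < (1/2)^n" and y: "\<And>n. y n \<in> K n"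
      and sy: "\<And>n. (s n, y n) \<in> C" by metis
    obtain l r where r: "strict_mono (r :: nat \<Rightarrow> nat)" and l: "(y \<circ> r) \<longlonglongrightarrow> l"
      using closed_totally_bounded_range_cluster[OF K(2,3) y] by blast
    have pow: "(\<lambda>n. (1/2 :: real)^n) \<longlonglongrightarrow> 0" by (rule LIMSEQ_realpow_zero) auto
    have "(\<lambda>n. dist (s n) t) \<longlonglongrightarrow> 0"
      by (rule tendsto_sandwich[OF _ _ tendsto_const pow])
        (auto intro!: always_eventually less_imp_le[OF s])
    then have "s \<longlonglongrightarrow> t" by (rule iffD2[OF tendsto_dist_iff])
    then have "(s \<circ> r) \<longlonglongrightarrow> t" using r by (rule LIMSEQ_subseq_LIMSEQ)
    with l have "(\<lambda>n. ((s \<circ> r) n, (y \<circ> r) n)) \<longlonglongrightarrow> (t, l)" by (intro tendsto_Pair)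
    then have "(t, l) \<in> C"
      by (rule closed_sequentially[OF C, rotated]) (simp add: sy)
    moreover have "l \<in> K n" for n
    proof (rule Lim_in_closed_set[OF K(1) _ _ l])
      have "(y \<circ> r) m \<in> K n" if "n \<le> m" for m
        using y[of "r m"] decseqD[OF K(2) order_trans[OF that seq_suble[OF r]]] by auto
      then show "\<forall>\<^sub>F m in sequentially. (y \<circ> r) m \<in> K n"
        unfolding eventually_sequentially by blast
    qed simp
    ultimately show "t \<in> {t. \<exists>y\<in>(\<Inter>n. K n). (t, y) \<in> C}" by blast
  qed
qed

lemma closed_projection_compact:
  fixes C :: "('t::metric_space \<times> 'y::complete_space) set"
  assumes "closed C" "compact K" "closed F"
  shows "closed {t. \<exists>y\<in>K \<inter> F. (t, y) \<in> C}"
proof -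
  have "\<exists>D. finite D \<and> K \<inter> F \<subseteq> (\<Union>d\<in>D. cball d ((1/2)^n))" for n
  proof -
    have "0 < (1/2 :: real)^n" by simp
    then obtain D where D: "finite D" "K \<subseteq> (\<Union>d\<in>D. ball d ((1/2)^n))"
      using \<open>compact K\<close> unfolding compact_eq_totally_bounded by blast
    moreover have "(\<Union>d\<in>D. ball d ((1/2)^n)) \<subseteq> (\<Union>d\<in>D. cball d ((1/2)^n))"
      by (intro UN_mono ball_subset_cball order_refl)
    ultimately show ?thesis by blast
  qed
  then have "{t. \<exists>y\<in>K \<inter> F. (t, y) \<in> C} = closure {t. \<exists>y\<in>K \<inter> F. (t, y) \<in> C}"
    using INT_closure_projection[of C "\<lambda>_. K \<inter> F"] assms
    by (auto simp: compact_imp_closed closed_Int decseq_def)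
  then show ?thesis using closed_closure[of "{t. \<exists>y\<in>K \<inter> F. (t, y) \<in> C}"] by (rule ssubst)
qed

lemma dense_sequence_exists:
  obtains d :: "nat \<Rightarrow> 'y::{metric_space, second_countable_topology}"
  where "\<And>y \<delta>. 0 < \<delta> \<Longrightarrow> \<exists>j. y \<in> cball (d j) \<delta>"
proof -
  obtain D :: "'y set" where D: "countable D" "\<And>U. open U \<Longrightarrow> U \<noteq> {} \<Longrightarrow> \<exists>d\<in>D. d \<in> U"
    using countable_dense_exists by blast
  then have "D \<noteq> {}" using open_UNIV by blast
  show ?thesis
  proof (rule that[of "from_nat_into D"])
    fix y and \<delta> :: real assume "0 < \<delta>"
    then obtain d where "d \<in> D" "d \<in> ball y \<delta>" using D(2)[of "ball y \<delta>"] by force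
    then show "\<exists>j. y \<in> cball (from_nat_into D j) \<delta>"
      using from_nat_into_surj[OF D(1)] by (metis dist_commute less_imp_le mem_ball mem_cball)
  qed
qed

text \<open>
  Over a compact set a closed relation has a Borel selector: successively restrict to the
  first ball of radius \<open>2\<^sup>-\<^sup>n\<close> that still meets the section. The tests involved are
  closed conditions on \<open>t\<close> by compactness, and the centres of the chosen balls converge.
\<close>

lemma borel_selection_compact:
  fixes C :: "('t::metric_space \<times> 'y::{complete_space, second_countable_topology}) set"
  assumes C: "closed C" and K: "compact K"
  obtains g where "g \<in> borel_measurable borel" "\<And>t y. y \<in> K \<Longrightarrow> (t, y) \<in> C \<Longrightarrow> (t, g t) \<in> C"
proof -
  obtain d :: "nat \<Rightarrow> 'y" where d: "\<And>y \<delta>. 0 < \<delta> \<Longrightarrow> \<exists>j. y \<in> cball (d j) \<delta>"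
    using dense_sequence_exists by blast
  \<comment> \<open>A list codes a choice of balls of radii \<open>1, 1/2, 1/4, \<dots>\<close>; \<open>D s\<close> consists of the \<open>t\<close> whose section
    meets all of them within \<open>K\<close>.\<close>
  define F where "F s = (\<Inter>m<length s. cball (d (s ! m)) ((1/2)^m))" for s
  define D where "D s = {t. \<exists>y\<in>K \<inter> F s. (t, y) \<in> C}" for s
  have D_closed: "closed (D s)" for s
    unfolding D_def F_def by (intro closed_projection_compact C K closed_INT ballI closed_cball)
  define pick where "pick t = rec_nat [] (\<lambda>n s. s @ [LEAST j. t \<in> D (s @ [j])])" for t
  have pick_simps: "pick t 0 = []" "pick t (Suc n) = pick t n @ [LEAST j. t \<in> D (pick t n @ [j])]" for t n
    by (simp_all add: pick_def)
  have len: "length (pick t n) = n" for t n by (induction n) (auto simp: pick_simps)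
  have pick_nth: "pick t n ! m = pick t (Suc m) ! m" if "m < n" for t n m
    using that by (induction n) (auto simp: pick_simps nth_append len less_Suc_eq)
  have pick_meas: "(\<lambda>t. pick t n) \<in> measurable borel (count_space UNIV)" for n
  proof (induction n)
    case 0
    show ?case by (simp add: pick_simps)
  next
    case (Suc n)
    have "Measurable.pred borel (\<lambda>t. t \<in> D (s @ [j]))" for s j
      using D_closed by (auto intro: borel_closed simp: pred_def)
    then have "(\<lambda>t. s @ [LEAST j. t \<in> D (s @ [j])]) \<in> measurable borel (count_space UNIV)" for s
      by (intro measurable_compose[OF measurable_Least]) auto
    from measurable_compose_countable[OF this Suc] show ?case by (simp add: pick_simps)
  qed
  define c where "c n t = d (pick t (Suc n) ! n)" for n t
  have c_meas: "c n \<in> borel_measurable borel" for n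
    unfolding c_def by (rule measurable_compose[OF pick_meas]) simp
  have pickD: "t \<in> D (pick t n)" if "t \<in> D []" for t n
  proof (induction n)
    case 0
    show ?case using that by (simp add: pick_simps)
  next
    case (Suc n)
    then obtain y where y: "y \<in> K" "y \<in> F (pick t n)" "(t, y) \<in> C" unfolding D_def by auto
    obtain j where "y \<in> cball (d j) ((1/2)^n)" using d[of "(1/2)^n" y] by auto
    with y have "y \<in> F (pick t n @ [j])"
      unfolding F_def by (auto simp: len nth_append less_Suc_eq)
    with y have "t \<in> D (pick t n @ [j])" unfolding D_def by blast
    then show ?case unfolding pick_simps by (rule LeastI)
  qed
  have limit: "\<exists>l. (\<lambda>n. c n t) \<longlonglongrightarrow> l \<and> (t, l) \<in> C" if t: "t \<in> D []" for t
  proof -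
    have "\<exists>y. y \<in> F (pick t (Suc n)) \<and> (t, y) \<in> C" for n
      using pickD[OF t, of "Suc n"] unfolding D_def by blast
    then obtain y where y: "\<And>n. y n \<in> F (pick t (Suc n))" "\<And>n. (t, y n) \<in> C" by metis
    have near: "dist (c m t) (y n) \<le> (1/2)^m" if "m \<le> n" for m n
    proof -
      have "y n \<in> cball (d (pick t (Suc n) ! m)) ((1/2)^m)"
        using y(1)[of n] that unfolding F_def by (auto simp: len)
      then show ?thesis using that pick_nth[of m "Suc n" t] by (simp add: c_def)
    qed
    have "Cauchy (\<lambda>n. c n t)"
      unfolding Cauchy_altdef2
    proof (intro allI impI)
      fix \<epsilon> :: real assume "0 < \<epsilon>"
      then obtain k where k: "(1/2 :: real)^k < \<epsilon> / 2"
        using real_arch_pow_inv[of "\<epsilon>/2" "1/2"] by auto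
      have "dist (c n t) (c k t) < \<epsilon>" if "k \<le> n" for n
      proof -
        have "dist (c n t) (c k t) \<le> dist (c n t) (y n) + dist (c k t) (y n)"
          by (rule dist_triangle2)
        also have "\<dots> \<le> (1/2)^n + (1/2)^k" using near[of n n] near[OF that] by simp
        also have "\<dots> \<le> (1/2)^k + (1/2)^k" using that by (simp add: power_decreasing)
        finally show ?thesis using k by simp
      qed
      then show "\<exists>k. \<forall>n\<ge>k. dist (c n t) (c k t) < \<epsilon>" by blast
    qed
    then obtain l where l: "(\<lambda>n. c n t) \<longlonglongrightarrow> l" by (auto simp: Cauchy_convergent_iff convergent_def)
    have pow: "(\<lambda>n. (1/2 :: real)^n) \<longlonglongrightarrow> 0" by (rule LIMSEQ_realpow_zero) auto
    have "(\<lambda>n. dist (c n t) (y n)) \<longlonglongrightarrow> 0"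
      by (rule tendsto_sandwich[OF _ _ tendsto_const pow]) (auto intro!: always_eventually near)
    from tendsto_add[OF this iffD1[OF tendsto_dist_iff l]]
    have sum: "(\<lambda>n. dist (c n t) (y n) + dist (c n t) l) \<longlonglongrightarrow> 0" by simp
    have "(\<lambda>n. dist (y n) l) \<longlonglongrightarrow> 0"
      by (rule tendsto_sandwich[OF _ _ tendsto_const sum])
        (auto intro!: always_eventually dist_triangle3)
    then have "y \<longlonglongrightarrow> l" by (rule iffD2[OF tendsto_dist_iff])
    then have "(\<lambda>n. (t, y n)) \<longlonglongrightarrow> (t, l)" by (intro tendsto_intros)
    then have "(t, l) \<in> C" by (rule closed_sequentially[OF C, rotated]) (simp add: y)
    with l show ?thesis by blast
  qed
  define g where "g t = (if t \<in> D [] then lim (\<lambda>n. c n t) else d 0)" for t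
  have "g \<in> borel_measurable borel"
  proof (rule borel_measurable_LIMSEQ_metric)
    show "(\<lambda>t. if t \<in> D [] then c n t else d 0) \<in> borel_measurable borel" for n
      using c_meas D_closed by (intro measurable_If_set) (auto intro: borel_closed)
    show "(\<lambda>n. if t \<in> D [] then c n t else d 0) \<longlonglongrightarrow> g t" for t
      using limit[of t] by (auto simp: g_def limI)
  qed
  moreover have "(t, g t) \<in> C" if "y \<in> K" "(t, y) \<in> C" for t y
  proof -
    have "t \<in> D []" using that unfolding D_def F_def by auto
    then show ?thesis using limit[of t] by (auto simp: g_def limI)
  qed
  ultimately show ?thesis using that by blast
qed

text \<open>
  The capacity argument. Outer measure is continuous along increasing sequences, so finitely many
  balls of radius \<open>2\<^sup>-\<^sup>n\<close> already capture a projection of outer measure above a fixed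
  \<open>c > 0\<close>. Doing so for every \<open>n\<close> leaves a compact set \<open>K\<close>; for the closures of the
  projections, which are measurable, continuity along decreasing sequences shows that \<open>K\<close>
  still captures outer measure at least \<open>c\<close>.
\<close>

lemma positive_measure_selection_closed:
  fixes C :: "('t::{metric_space, second_countable_topology} \<times> 'y::{complete_space, second_countable_topology}) set"
  assumes C: "closed C" and h: "h \<in> borel_measurable M"
    and \<Omega>: "\<Omega> \<in> sets M" "emeasure M \<Omega> < \<infinity>"
    and pos: "0 < outer_measure_of M {w\<in>\<Omega>. \<exists>y. (h w, y) \<in> C}"
  obtains A y where "A \<in> sets M" "0 < emeasure M A" "y \<in> borel_measurable M"
    "\<And>w. w \<in> A \<Longrightarrow> (h w, y w) \<in> C"
proof -
  obtain d :: "nat \<Rightarrow> 'y" where d: "\<And>y \<delta>. 0 < \<delta> \<Longrightarrow> \<exists>j. y \<in> cball (d j) \<delta>"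
    using dense_sequence_exists by blast
  define S where "S K = {w\<in>\<Omega>. \<exists>y\<in>K. (h w, y) \<in> C}" for K
  have S_space: "S K \<subseteq> space M" for K
    using sets.sets_into_space[OF \<Omega>(1)] by (auto simp: S_def)
  obtain c where c: "0 < c" "c < outer_measure_of M (S UNIV)"
    using dense[OF pos] by (auto simp: S_def)
  have "\<exists>K. \<forall>n. (closed (K n) \<and> c < outer_measure_of M (S (K n))) \<and>
      (K (Suc n) \<subseteq> K n \<and> (\<exists>F. finite F \<and> K (Suc n) \<subseteq> (\<Union>d\<in>F. cball d ((1/2)^n))))"
  proof (rule dependent_nat_choice)
    show "\<exists>K. closed K \<and> c < outer_measure_of M (S K)" using c by (intro exI[of _ UNIV]) auto
  next
    fix K n assume K: "closed K \<and> c < outer_measure_of M (S K)"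
    define L where "L k = K \<inter> (\<Union>j\<le>k. cball (d j) ((1/2)^n))" for k
    have "(\<Union>k. L k) = K"
    proof -
      have "x \<in> (\<Union>k. L k)" if "x \<in> K" for x
      proof -
        obtain j where "x \<in> cball (d j) ((1/2)^n)" using d[of "(1/2)^n" x] by auto
        with that have "x \<in> L j" unfolding L_def by blast
        then show ?thesis by blast
      qed
      then show ?thesis by (auto simp: L_def)
    qed
    then have "S K = (\<Union>k. S (L k))" by (auto simp: S_def)
    moreover have "incseq (\<lambda>k. S (L k))"
    proof (rule monoI)
      fix j k :: nat assume "j \<le> k"
      then have "L j \<subseteq> L k" unfolding L_def by (intro Int_mono UN_mono) auto
      then show "S (L j) \<subseteq> S (L k)" unfolding S_def by blast
    qed
    ultimately have "(SUP k. outer_measure_of M (S (L k))) = outer_measure_of M (S K)"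
      using SUP_outer_measure_of_incseq[of "\<lambda>k. S (L k)" M] S_space by simp
    then obtain k where "c < outer_measure_of M (S (L k))"
      using K less_SUP_iff[of c "\<lambda>k. outer_measure_of M (S (L k))" UNIV] by auto
    moreover have "closed (L k)" unfolding L_def using K by (intro closed_Int closed_UN) auto
    moreover have "finite (d ` {..k})" "L k \<subseteq> (\<Union>d\<in>d ` {..k}. cball d ((1/2)^n))"
      by (auto simp: L_def)
    ultimately show "\<exists>K'. (closed K' \<and> c < outer_measure_of M (S K')) \<and>
      (K' \<subseteq> K \<and> (\<exists>F. finite F \<and> K' \<subseteq> (\<Union>d\<in>F. cball d ((1/2)^n))))"
      by (intro exI[of _ "L k"] conjI exI[of _ "d ` {..k}"]) (auto simp: L_def)
  qed
  then obtain K0 where K0: "\<And>n. closed (K0 n)" "\<And>n. c < outer_measure_of M (S (K0 n))"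
    "\<And>n. K0 (Suc n) \<subseteq> K0 n" "\<And>n. \<exists>F. finite F \<and> K0 (Suc n) \<subseteq> (\<Union>d\<in>F. cball d ((1/2)^n))"
    by blast
  define K where "K n = K0 (Suc n)" for n
  have K: "\<And>n. closed (K n)" "decseq K" "\<And>n. \<exists>F. finite F \<and> K n \<subseteq> (\<Union>d\<in>F. cball d ((1/2)^n))"
    and Kc: "\<And>n. c < outer_measure_of M (S (K n))"
    unfolding K_def using K0 by (simp_all add: decseq_SucI)
  have compact: "compact (\<Inter>n. K n)"
    unfolding compact_eq_totally_bounded
  proof (intro conjI allI impI)
    show "complete (\<Inter>n. K n)" using K(1) by (auto simp: complete_eq_closed)
    fix \<epsilon> :: real assume "0 < \<epsilon>"
    then obtain m where m: "(1/2 :: real)^m < \<epsilon>"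
      using real_arch_pow_inv[of "\<epsilon>" "1/2"] by auto
    obtain F where F: "finite F" "K m \<subseteq> (\<Union>d\<in>F. cball d ((1/2)^m))" using K(3) by blast
    have "(\<Union>d\<in>F. cball d ((1/2)^m)) \<subseteq> (\<Union>d\<in>F. ball d \<epsilon>)" using m
      by (intro UN_mono[OF order_refl]) (auto simp: subset_eq)
    then have "(\<Inter>n. K n) \<subseteq> (\<Union>d\<in>F. ball d \<epsilon>)" using F(2) by blast
    then show "\<exists>k. finite k \<and> (\<Inter>n. K n) \<subseteq> (\<Union>x\<in>k. ball x \<epsilon>)" using F(1) by blast
  qed
  define T where "T n = h -` closure {t. \<exists>y\<in>K n. (t, y) \<in> C} \<inter> \<Omega>" for n
  have T_eq: "T n = (h -` closure {t. \<exists>y\<in>K n. (t, y) \<in> C} \<inter> space M) \<inter> \<Omega>" for n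
    using sets.sets_into_space[OF \<Omega>(1)] by (auto simp: T_def)
  have T: "T n \<in> sets M" for n
    unfolding T_eq using \<Omega> by (intro sets.Int measurable_sets[OF h]) auto
  have "decseq T"
    unfolding decseq_def T_def
  proof (intro allI impI Int_mono vimage_mono closure_mono order_refl)
    fix m n :: nat assume "m \<le> n"
    then have "K n \<subseteq> K m" using K(2) by (simp add: decseq_def)
    then show "{t. \<exists>y\<in>K n. (t, y) \<in> C} \<subseteq> {t. \<exists>y\<in>K m. (t, y) \<in> C}" by blast
  qed
  have "c \<le> emeasure M (T n)" for n
  proof -
    have "S (K n) \<subseteq> T n" using closure_subset by (fastforce simp: S_def T_def)
    then have "outer_measure_of M (S (K n)) \<le> emeasure M (T n)"
      using outer_measure_of_mono[of "S (K n)" "T n" M] T by simp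
    then show ?thesis using Kc[of n] by simp
  qed
  then have "c \<le> (INF n. emeasure M (T n))" by (intro INF_greatest)
  also have "\<dots> = emeasure M (\<Inter>n. T n)"
  proof (rule INF_emeasure_decseq')
    have "emeasure M (T 0) \<le> emeasure M \<Omega>" using \<Omega> by (intro emeasure_mono) (auto simp: T_def)
    then show "\<exists>i. emeasure M (T i) \<noteq> \<infinity>" using \<Omega>(2) by (metis infinity_ennreal_def leD)
  qed (use T \<open>decseq T\<close> in auto)
  finally have "0 < emeasure M (\<Inter>n. T n)" using c(1) by simp
  moreover have "(\<Inter>n. T n) \<in> sets M" using T by auto
  moreover obtain g where g: "g \<in> borel_measurable borel"
    "\<And>t y. y \<in> (\<Inter>n. K n) \<Longrightarrow> (t, y) \<in> C \<Longrightarrow> (t, g t) \<in> C"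
    using borel_selection_compact[OF C compact] by metis
  moreover have "(\<lambda>w. g (h w)) \<in> borel_measurable M"
    using h g(1) by (rule measurable_compose)
  moreover have "(h w, g (h w)) \<in> C" if "w \<in> (\<Inter>n. T n)" for w
  proof -
    have "h w \<in> (\<Inter>n. closure {t. \<exists>y\<in>K n. (t, y) \<in> C})" using that by (auto simp: T_def)
    then show ?thesis unfolding INT_closure_projection[OF C K] using g(2) by blast
  qed
  ultimately show ?thesis using that by blast
qed

text \<open>
  The contrapositive of measurable selection on sets of positive measure: if the projection of \<open>G\<close>
  had positive outer measure inside some set of finite measure, a selection of \<open>G\<close> would exist over a set of
  positive measure. The fibre variable of the selection is the pair of \<open>e\<close> and the auxiliary sequence.
\<close>

theorem AE_sections_empty_if_no_selection:
  fixes G :: "('w \<times> 'e::{complete_space, second_countable_topology}) set"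
  assumes "sigma_finite_measure M" and G: "G \<in> sets (M \<Otimes>\<^sub>M borel)"
    and null: "\<And>x. x \<in> borel_measurable M \<Longrightarrow> AE w in M. (w, x w) \<notin> G"
  shows "AE w in M. \<forall>e. (w, e) \<notin> G"
proof -
  interpret sigma_finite_measure M by fact
  obtain h :: "'w \<Rightarrow> nat \<Rightarrow> real" and B where h: "h \<in> borel_measurable M" and "B \<in> sets borel"
    and G_eq: "G = {(w, e). w \<in> space M \<and> (h w, e) \<in> B}"
    by (rule product_measurable_eq_vimage_borel[OF G])
  obtain C0 :: "(((nat \<Rightarrow> real) \<times> 'e) \<times> (nat \<Rightarrow> real)) set"
    where C0: "closed C0" "B = {p. \<exists>\<sigma>. (p, \<sigma>) \<in> C0}"
    using souslin_borel[OF \<open>B \<in> sets borel\<close>] unfolding souslin_def by blast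
  define C where "C = (\<lambda>(t, e, \<sigma>). ((t, e), \<sigma>)) -` C0"
  have "closed C"
    unfolding C_def case_prod_unfold using C0(1) by (intro closed_vimage continuous_intros)
  obtain F :: "nat \<Rightarrow> 'w set" where F: "range F \<subseteq> sets M" "(\<Union>i. F i) = space M"
    "\<And>i. emeasure M (F i) \<noteq> \<infinity>"
    by (rule sigma_finite) blast
  have F_sets: "F n \<in> sets M" for n using F(1) by auto
  have zero: "outer_measure_of M {w\<in>F n. \<exists>y. (h w, y) \<in> C} = 0" for n
  proof (rule ccontr)
    assume "outer_measure_of M {w\<in>F n. \<exists>y. (h w, y) \<in> C} \<noteq> 0"
    then have pos: "0 < outer_measure_of M {w\<in>F n. \<exists>y. (h w, y) \<in> C}" by (simp add: zero_less_iff_neq_zero)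
    have "emeasure M (F n) < \<infinity>" using F(3)[of n] by (simp add: less_top[symmetric])
    then obtain A y where A: "A \<in> sets M" "0 < emeasure M A" and y: "y \<in> borel_measurable M"
      "\<And>w. w \<in> A \<Longrightarrow> (h w, y w) \<in> C"
      using positive_measure_selection_closed[OF \<open>closed C\<close> h F_sets[of n] _ pos] by blast
    have "(\<lambda>w. fst (y w)) \<in> borel_measurable M"
      by (rule measurable_compose[OF y(1)]) (intro borel_measurable_continuous_onI continuous_intros)
    then have "AE w in M. (w, fst (y w)) \<notin> G" by (rule null)
    moreover have "(w, fst (y w)) \<in> G" if "w \<in> A" for w
    proof -
      have "((h w, fst (y w)), snd (y w)) \<in> C0" using y(2)[OF that] by (simp add: C_def case_prod_unfold)
      then show ?thesis using that sets.sets_into_space[OF A(1)] by (auto simp: G_eq C0(2))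
    qed
    ultimately have "AE w in M. w \<notin> A" by (auto elim: eventually_mono)
    then have "emeasure M A = 0" using A(1) by (simp add: AE_iff_null_sets[symmetric] null_setsD1)
    with A(2) show False by simp
  qed
  have "\<exists>E. E \<in> null_sets M \<and> {w\<in>F n. \<exists>y. (h w, y) \<in> C} \<subseteq> E" for n
  proof -
    have "{w\<in>F n. \<exists>y. (h w, y) \<in> C} \<subseteq> space M" using sets.sets_into_space[OF F_sets] by blast
    from outer_measure_of_attain[OF this] show ?thesis using zero[of n] by (auto simp: null_sets_def)
  qed
  then have "\<exists>E. \<forall>n. E n \<in> null_sets M \<and> {w\<in>F n. \<exists>y. (h w, y) \<in> C} \<subseteq> E n"
    by (intro choice allI)
  then obtain E where E: "\<And>n. E n \<in> null_sets M" "\<And>n. {w\<in>F n. \<exists>y. (h w, y) \<in> C} \<subseteq> E n"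
    by blast
  show ?thesis
  proof (rule AE_I')
    show "(\<Union>n. E n) \<in> null_sets M" using E(1) by auto
    show "{w\<in>space M. \<not> (\<forall>e. (w, e) \<notin> G)} \<subseteq> (\<Union>n. E n)"
    proof
      fix w assume "w \<in> {w\<in>space M. \<not> (\<forall>e. (w, e) \<notin> G)}"
      then obtain e where w: "w \<in> space M" "(w, e) \<in> G" by blast
      then obtain \<sigma> where "((h w, e), \<sigma>) \<in> C0" by (auto simp: G_eq C0(2))
      then have "(h w, (e, \<sigma>)) \<in> C" by (simp add: C_def)
      moreover obtain n where "w \<in> F n" using w F(2) by blast
      ultimately show "w \<in> (\<Union>n. E n)" using E(2)[of n] by blast
    qed
  qed
qed

section \<open>Upper integrals\<close>

lemma le_upper_integral_iff:
  "ereal z \<le> upper_integral M v \<longleftrightarrow>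
    (\<forall>u. integrable M u \<longrightarrow> (AE w in M. v w \<le> ereal (u w)) \<longrightarrow> z \<le> integral\<^sup>L M u)"
  unfolding upper_integral_def le_INF_iff by auto

lemma upper_integral_le:
  "integrable M u \<Longrightarrow> AE w in M. v w \<le> ereal (u w) \<Longrightarrow> upper_integral M v \<le> ereal (integral\<^sup>L M u)"
  unfolding upper_integral_def by (intro INF_lower) auto

lemma ereal_eq_by_real_minorants:
  assumes "\<And>z. ereal z \<le> x \<longleftrightarrow> ereal z \<le> y"
  shows "x = y"
proof (rule ccontr)
  assume "x \<noteq> y"
  then consider "x < y" | "y < x" by (rule linorder_neqE)
  then show False
  proof cases
    case 1
    then obtain z where "x < ereal z" "ereal z < y" using ereal_dense2 by blast
    then show False using assms[of z] by auto
  next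
    case 2
    then obtain z where "y < ereal z" "ereal z < x" using ereal_dense2 by blast
    then show False using assms[of z] by auto
  qed
qed

lemma upper_integral_cong_AE:
  assumes "AE w in M. v w = v' w"
  shows "upper_integral M v = upper_integral M v'"
proof (rule ereal_eq_by_real_minorants)
  have "(AE w in M. v w \<le> ereal (u w)) \<longleftrightarrow> (AE w in M. v' w \<le> ereal (u w))" for u
  proof
    show "AE w in M. v' w \<le> ereal (u w)" if "AE w in M. v w \<le> ereal (u w)"
      using that assms by eventually_elim simp
    show "AE w in M. v w \<le> ereal (u w)" if "AE w in M. v' w \<le> ereal (u w)"
      using that assms by eventually_elim simp
  qed
  then show "ereal z \<le> upper_integral M v \<longleftrightarrow> ereal z \<le> upper_integral M v'" for z
    unfolding le_upper_integral_iff by simp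
qed

lemma ereal_affine_le_iff:
  fixes c \<alpha> \<beta> z :: real
  assumes "0 < c"
  shows "ereal c * (y - ereal \<alpha>) - ereal \<beta> \<le> ereal z \<longleftrightarrow> y \<le> ereal ((z + \<beta>) / c + \<alpha>)"
    and "ereal z \<le> ereal c * (y - ereal \<alpha>) - ereal \<beta> \<longleftrightarrow> ereal ((z + \<beta>) / c + \<alpha>) \<le> y"
  using assms by (cases y; simp add: field_simps)+

text \<open>
  An integrable correction acts on the competing integrable majorants by a bijective affine change,
  hence commutes with the upper integral, even for non-measurable \<open>v\<close>.
\<close>

lemma upper_integral_affine:
  assumes c: "0 < c" and a: "integrable M a" and b: "integrable M b"
  shows "upper_integral M (\<lambda>w. ereal c * (v w - ereal (a w)) - ereal (b w))
    = ereal c * (upper_integral M v - ereal (integral\<^sup>L M a)) - ereal (integral\<^sup>L M b)"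
    (is "?L = ?R")
proof (rule ereal_eq_by_real_minorants)
  fix z
  have L: "ereal z \<le> ?L \<longleftrightarrow> (\<forall>u. integrable M u \<longrightarrow>
      (AE w in M. v w \<le> ereal ((u w + b w) / c + a w)) \<longrightarrow> z \<le> integral\<^sup>L M u)"
    by (simp add: le_upper_integral_iff ereal_affine_le_iff(1)[OF c])
  have R: "ereal z \<le> ?R \<longleftrightarrow> (\<forall>u. integrable M u \<longrightarrow> (AE w in M. v w \<le> ereal (u w)) \<longrightarrow>
      (z + integral\<^sup>L M b) / c + integral\<^sup>L M a \<le> integral\<^sup>L M u)"
    by (simp add: le_upper_integral_iff ereal_affine_le_iff(2)[OF c])
  show "ereal z \<le> ?L \<longleftrightarrow> ereal z \<le> ?R"
    unfolding L R
  proof (intro iffI allI impI)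
    fix u assume *: "\<forall>u. integrable M u \<longrightarrow>
      (AE w in M. v w \<le> ereal ((u w + b w) / c + a w)) \<longrightarrow> z \<le> integral\<^sup>L M u"
      and u: "integrable M u" "AE w in M. v w \<le> ereal (u w)"
    have "integrable M (\<lambda>w. c * (u w - a w) - b w)" using u(1) a b by simp
    moreover have "AE w in M. v w \<le> ereal ((c * (u w - a w) - b w + b w) / c + a w)"
      using u(2) c by simp
    ultimately have "z \<le> (LINT w|M. c * (u w - a w) - b w)" using * by blast
    also have "\<dots> = c * (integral\<^sup>L M u - integral\<^sup>L M a) - integral\<^sup>L M b"
      using u(1) a b by simp
    finally show "(z + integral\<^sup>L M b) / c + integral\<^sup>L M a \<le> integral\<^sup>L M u"
      using c by (simp add: field_simps)
  next
    fix u assume *: "\<forall>u. integrable M u \<longrightarrow> (AE w in M. v w \<le> ereal (u w)) \<longrightarrow>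
      (z + integral\<^sup>L M b) / c + integral\<^sup>L M a \<le> integral\<^sup>L M u"
      and u: "integrable M u" "AE w in M. v w \<le> ereal ((u w + b w) / c + a w)"
    have "integrable M (\<lambda>w. (u w + b w) / c + a w)" using u(1) a b by simp
    then have "(z + integral\<^sup>L M b) / c + integral\<^sup>L M a \<le> (LINT w|M. (u w + b w) / c + a w)"
      using * u(2) by blast
    also have "\<dots> = (integral\<^sup>L M u + integral\<^sup>L M b) / c + integral\<^sup>L M a"
      using u(1) a b by simp
    finally show "z \<le> integral\<^sup>L M u" using c by (simp add: divide_le_cancel)
  qed
qed

text \<open>
  A measurable function with finite upper integral lies below some integrable \<open>u\<close>. Were the gap
  not integrable, integrable parts of it of arbitrarily large integral could be subtracted from
  \<open>u\<close>, and the upper integral would be \<open>-\<infinity>\<close>.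
\<close>

lemma finite_upper_integral_imp_integrable:
  assumes "sigma_finite_measure M" and v: "v \<in> borel_measurable M"
    and fin: "\<bar>upper_integral M v\<bar> \<noteq> \<infinity>"
  obtains a :: "_ \<Rightarrow> real" where "integrable M a" "AE w in M. v w = ereal (a w)"
    "upper_integral M v = ereal (integral\<^sup>L M a)"
proof -
  interpret sigma_finite_measure M by fact
  have "upper_integral M v < \<infinity>" using fin by auto
  then obtain u :: "_ \<Rightarrow> real" where u: "integrable M u" "AE w in M. v w \<le> ereal (u w)"
    unfolding upper_integral_def INF_less_iff by auto
  note [measurable] = v borel_measurable_integrable[OF u(1)]
  define gap where "gap w = e2ennreal (ereal (u w) - v w)" for w
  have [measurable]: "gap \<in> borel_measurable M" unfolding gap_def by measurable
  obtain F :: "nat \<Rightarrow> _ set" where F: "range F \<subseteq> sets M" "(\<Union>i. F i) = space M"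
    "\<And>i. emeasure M (F i) \<noteq> \<infinity>" "incseq F"
    by (rule sigma_finite_incseq) blast
  have [measurable]: "F n \<in> sets M" for n using F(1) by auto
  obtain z where z: "upper_integral M v = ereal z" using fin by (cases "upper_integral M v") auto
  have nat_top: "of_nat n < (top :: ennreal)" for n :: nat
    unfolding ennreal_of_nat_eq_real_of_nat by (rule ennreal_less_top)
  define t where "t n w = enn2real (min (gap w) (of_nat n)) * indicator (F n) w" for n w
  have t_meas[measurable]: "t n \<in> borel_measurable M" for n unfolding t_def by measurable
  have t_bound: "0 \<le> t n w" "t n w \<le> real n" for n w
  proof -
    have "enn2real (min (gap w) (of_nat n)) \<le> enn2real (of_nat n)"
      using nat_top by (intro enn2real_mono) auto
    then show "0 \<le> t n w" "t n w \<le> real n" by (auto simp: t_def indicator_def)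
  qed
  have t_int: "integrable M (t n)" for n
  proof (rule integrableI_bounded_set[where A = "F n" and B = "real n"])
    show "emeasure M (F n) < \<infinity>" using F(3)[of n] by (simp add: less_top[symmetric])
    show "AE w in M. w \<in> F n \<longrightarrow> norm (t n w) \<le> real n" using t_bound[of n] by simp
    show "AE w in M. w \<notin> F n \<longrightarrow> t n w = 0" by (simp add: t_def)
  qed auto
  have t_enn: "ennreal (t n w) = min (gap w) (of_nat n) * indicator (F n) w" for n w
  proof -
    have "min (gap w) (of_nat n) < top" using nat_top by (simp add: min_less_iff_disj)
    then show ?thesis by (auto simp: t_def indicator_def)
  qed
  have below: "AE w in M. v w \<le> ereal (u w - t n w)" for n
    using u(2)
  proof eventually_elim
    case (elim w)
    have "enn2ereal (ennreal (t n w)) \<le> enn2ereal (gap w)"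
      unfolding t_enn less_eq_ennreal.rep_eq[symmetric] by (auto simp: indicator_def)
    also have "enn2ereal (gap w) = ereal (u w) - v w"
      unfolding gap_def using elim by (intro enn2ereal_e2ennreal) (cases "v w", auto)
    finally show ?case using t_bound[of n w] by (cases "v w") auto
  qed
  have "z \<le> integral\<^sup>L M u - integral\<^sup>L M (t n)" for n
  proof -
    have "upper_integral M v \<le> ereal (LINT w|M. u w - t n w)"
      using u(1) t_int[of n] below[of n] by (intro upper_integral_le) auto
    then show ?thesis using z u(1) t_int[of n] by simp
  qed
  then have t_le: "integral\<^sup>L M (t n) \<le> integral\<^sup>L M u - z" for n by (simp add: algebra_simps)
  have "(\<integral>\<^sup>+w. gap w \<partial>M) = (\<integral>\<^sup>+w. (SUP n. ennreal (t n w)) \<partial>M)"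
  proof (intro nn_integral_cong)
    fix w assume "w \<in> space M"
    then obtain m where m: "w \<in> F m" using F(2) by blast
    show "gap w = (SUP n. ennreal (t n w))"
    proof (rule antisym)
      show "(SUP n. ennreal (t n w)) \<le> gap w"
        unfolding t_enn by (intro SUP_least) (auto simp: indicator_def)
      have "gap w = min (gap w) (SUP n. of_nat n)" by (simp add: ennreal_SUP_of_nat_eq_top)
      also have "\<dots> = (SUP n. min (gap w) (of_nat n))"
        by (simp add: inf_min[symmetric] inf_SUP)
      also have "\<dots> \<le> (SUP n. ennreal (t n w))"
      proof (rule SUP_mono)
        fix n :: nat
        have "w \<in> F (max m n)" using m incseqD[OF F(4), of m "max m n"] by auto
        then show "\<exists>k\<in>UNIV. min (gap w) (of_nat n) \<le> ennreal (t k w)"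
          unfolding t_enn
          by (intro bexI[of _ "max m n"]) (auto intro: order_trans[OF min.cobounded2 of_nat_mono])
      qed
      finally show "gap w \<le> (SUP n. ennreal (t n w))" .
    qed
  qed
  also have "\<dots> = (SUP n. \<integral>\<^sup>+w. ennreal (t n w) \<partial>M)"
  proof (intro nn_integral_monotone_convergence_SUP)
    show "incseq (\<lambda>n w. ennreal (t n w))"
    proof (intro incseq_SucI le_funI)
      fix n w show "ennreal (t n w) \<le> ennreal (t (Suc n) w)"
        unfolding t_enn using incseq_SucD[OF F(4), of n]
        by (auto simp: indicator_def simp del: of_nat_Suc
            intro: order_trans[OF min.cobounded2 of_nat_mono])
    qed
  qed auto
  also have "\<dots> \<le> ennreal (integral\<^sup>L M u - z)"
    using t_bound t_int t_le by (intro SUP_least) (simp add: nn_integral_eq_integral ennreal_leI)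
  finally have gap_fin: "(\<integral>\<^sup>+w. gap w \<partial>M) < \<infinity>" by (simp add: order_le_less_trans)
  have gap_AE: "AE w in M. gap w \<noteq> \<infinity>"
    using gap_fin by (intro nn_integral_PInf_AE) auto
  define a where "a w = u w - enn2real (gap w)" for w
  have "integrable M (\<lambda>w. enn2real (gap w))"
  proof (rule integrableI_nonneg)
    have "(\<integral>\<^sup>+w. ennreal (enn2real (gap w)) \<partial>M) = (\<integral>\<^sup>+w. gap w \<partial>M)"
      using gap_AE by (intro nn_integral_cong_AE) (auto elim!: eventually_mono simp: less_top)
    then show "(\<integral>\<^sup>+w. ennreal (enn2real (gap w)) \<partial>M) < \<infinity>" using gap_fin by simp
  qed auto
  then have a: "integrable M a" unfolding a_def using u(1) by simp
  moreover have va: "AE w in M. v w = ereal (a w)"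
    using u(2) gap_AE
  proof eventually_elim
    case (elim w)
    have eq: "enn2ereal (gap w) = ereal (u w) - v w"
      unfolding gap_def using elim by (intro enn2ereal_e2ennreal) (cases "v w", auto)
    have "ereal (enn2real (gap w)) = enn2ereal (gap w)"
      using elim(2) by (cases "gap w") (auto simp: enn2ereal_ennreal)
    with eq show ?case by (cases "v w") (auto simp: a_def)
  qed
  moreover have "upper_integral M v = ereal (integral\<^sup>L M a)"
  proof (rule antisym)
    show "upper_integral M v \<le> ereal (integral\<^sup>L M a)"
      using va by (intro upper_integral_le[OF a]) (auto elim: eventually_mono)
    show "ereal (integral\<^sup>L M a) \<le> upper_integral M v"
      unfolding le_upper_integral_iff
    proof (intro allI impI)
      fix s assume s: "integrable M s" "AE w in M. v w \<le> ereal (s w)"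
      have "AE w in M. a w \<le> s w" using s(2) va by eventually_elim simp
      then show "integral\<^sup>L M a \<le> integral\<^sup>L M s" by (rule integral_mono_AE[OF a s(1)])
    qed
  qed
  ultimately show ?thesis by (rule that)
qed

section \<open>Essential suprema and atomless measures\<close>

text \<open>
  The essential supremum of a family of measurable functions, obtained as the limit of an increasing
  maximizing sequence. Maximality of its integral forces every member of the family below it.
\<close>

lemma essential_supremum_of_max_closed_family:
  fixes H :: "('w \<Rightarrow> ennreal) set"
  assumes meas: "H \<subseteq> borel_measurable M" and "H \<noteq> {}"
    and max: "\<And>h k. h \<in> H \<Longrightarrow> k \<in> H \<Longrightarrow> (\<lambda>w. max (h w) (k w)) \<in> H"
    and fin: "(SUP h\<in>H. \<integral>\<^sup>+w. h w \<partial>M) < \<infinity>"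
  shows "\<exists>u\<in>borel_measurable M. (\<integral>\<^sup>+w. u w \<partial>M) = (SUP h\<in>H. \<integral>\<^sup>+w. h w \<partial>M)
    \<and> (\<forall>h\<in>H. AE w in M. h w \<le> u w)"
proof -
  define \<beta> where "\<beta> = (SUP h\<in>H. \<integral>\<^sup>+w. h w \<partial>M)"
  have upper: "(\<integral>\<^sup>+w. h w \<partial>M) \<le> \<beta>" if "h \<in> H" for h
    unfolding \<beta>_def using that by (rule SUP_upper)
  obtain J :: "nat \<Rightarrow> ennreal" where J: "range J \<subseteq> (\<lambda>h. \<integral>\<^sup>+w. h w \<partial>M) ` H" "\<beta> = Sup (range J)"
    using ennreal_SUP_countable_SUP[OF \<open>H \<noteq> {}\<close>, of "\<lambda>h. \<integral>\<^sup>+w. h w \<partial>M"] unfolding \<beta>_def by blast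
  have "\<exists>h. h \<in> H \<and> J n = (\<integral>\<^sup>+w. h w \<partial>M)" for n using J(1) by blast
  then have "\<exists>h. \<forall>n. h n \<in> H \<and> J n = (\<integral>\<^sup>+w. h n w \<partial>M)" by (intro choice allI)
  then obtain h where h: "\<And>n. h n \<in> H" "\<And>n. J n = (\<integral>\<^sup>+w. h n w \<partial>M)" by blast
  define k where "k = rec_nat (h 0) (\<lambda>n g w. max (g w) (h (Suc n) w))"
  have k_simps: "k 0 = h 0" "k (Suc n) = (\<lambda>w. max (k n w) (h (Suc n) w))" for n
    by (simp_all add: k_def)
  have kH: "k n \<in> H" for n by (induction n) (auto simp: k_simps h max)
  have hk: "h n w \<le> k n w" for n w by (cases n) (auto simp: k_simps)
  have inc: "incseq k" by (rule incseq_SucI) (simp add: k_simps le_fun_def)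
  have [measurable]: "k n \<in> borel_measurable M" for n using kH meas by blast
  define u where "u w = (SUP n. k n w)" for w
  have u_meas[measurable]: "u \<in> borel_measurable M" unfolding u_def by measurable
  have u_int: "(\<integral>\<^sup>+w. u w \<partial>M) = \<beta>"
  proof (rule antisym)
    have "(\<integral>\<^sup>+w. u w \<partial>M) = (SUP n. \<integral>\<^sup>+w. k n w \<partial>M)"
      unfolding u_def by (intro nn_integral_monotone_convergence_SUP inc) auto
    also have "\<dots> \<le> \<beta>" by (intro SUP_least upper kH)
    finally show "(\<integral>\<^sup>+w. u w \<partial>M) \<le> \<beta>" .
    show "\<beta> \<le> (\<integral>\<^sup>+w. u w \<partial>M)"
      unfolding J(2)
    proof (rule SUP_least)
      fix n
      have "k n w \<le> u w" for w unfolding u_def by (rule SUP_upper) simp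
      then have "h n w \<le> u w" for w using hk order_trans by blast
      then show "J n \<le> (\<integral>\<^sup>+w. u w \<partial>M)" unfolding h(2) by (intro nn_integral_mono)
    qed
  qed
  have "AE w in M. g w \<le> u w" if g: "g \<in> H" for g
  proof -
    have [measurable]: "g \<in> borel_measurable M" using g meas by blast
    have "(\<integral>\<^sup>+w. max (u w) (g w) \<partial>M) = (\<integral>\<^sup>+w. (SUP n. max (k n w) (g w)) \<partial>M)"
      unfolding u_def by (intro nn_integral_cong) (simp add: sup_max[symmetric] SUP_sup_distrib[symmetric])
    also have "\<dots> = (SUP n. \<integral>\<^sup>+w. max (k n w) (g w) \<partial>M)"
    proof (intro nn_integral_monotone_convergence_SUP)
      show "incseq (\<lambda>n w. max (k n w) (g w))"
        by (intro incseq_SucI le_funI) (simp add: k_simps max.assoc[symmetric] max.coboundedI1)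
    qed auto
    also have "\<dots> \<le> \<beta>" by (intro SUP_least upper max kH g)
    finally have le: "(\<integral>\<^sup>+w. max (u w) (g w) \<partial>M) \<le> \<beta>" .
    have "(\<integral>\<^sup>+w. (max (u w) (g w) - u w) \<partial>M) = (\<integral>\<^sup>+w. max (u w) (g w) \<partial>M) - (\<integral>\<^sup>+w. u w \<partial>M)"
      using fin[folded \<beta>_def] u_int by (intro nn_integral_diff) (auto simp: less_top)
    also have "\<dots> = 0"
      unfolding u_int using le fin[folded \<beta>_def]
      by (intro diff_eq_0_ennreal) (auto simp: less_top intro: order_le_less_trans)
    finally have "AE w in M. max (u w) (g w) - u w = 0" by (subst (asm) nn_integral_0_iff_AE) auto
    then show ?thesis
    proof eventually_elim
      case (elim w)
      then have "max (u w) (g w) \<le> u w" by (rule ennreal_minus_eq_0)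
      then show ?case by simp
    qed
  qed
  with u_meas u_int show ?thesis unfolding \<beta>_def by blast
qed

text \<open>
  Splitting a set and keeping the smaller part at least halves the measure, so iteration reaches
  arbitrarily small positive measures.
\<close>

lemma (in finite_measure) small_positive_subset:
  assumes split: "\<And>A. A \<in> sets M \<Longrightarrow> 0 < measure M A \<Longrightarrow>
      \<exists>B\<in>sets M. B \<subseteq> A \<and> 0 < measure M B \<and> 0 < measure M (A - B)"
    and A: "A \<in> sets M" "0 < measure M A" and "0 < \<eta>"
  shows "\<exists>B\<in>sets M. B \<subseteq> A \<and> 0 < measure M B \<and> measure M B \<le> \<eta>"
proof -
  have "\<exists>B\<in>sets M. B \<subseteq> A \<and> 0 < measure M B \<and> measure M B \<le> measure M A * (1/2)^n" for n
  proof (induction n)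
    case 0
    show ?case using A by auto
  next
    case (Suc n)
    then obtain B where B: "B \<in> sets M" "B \<subseteq> A" "0 < measure M B" "measure M B \<le> measure M A * (1/2)^n"
      by blast
    obtain D where D: "D \<in> sets M" "D \<subseteq> B" "0 < measure M D" "0 < measure M (B - D)"
      using split[OF B(1,3)] by blast
    have sum: "measure M (B - D) = measure M B - measure M D" by (intro finite_measure_Diff B D)
    have "\<exists>D'\<in>sets M. D' \<subseteq> B \<and> 0 < measure M D' \<and> measure M D' \<le> measure M B / 2"
    proof (cases "measure M D \<le> measure M B / 2")
      case True
      then show ?thesis using D by blast
    next
      case False
      then show ?thesis using D(4) sum B(1) D(1) by (intro bexI[of _ "B - D"]) auto
    qed
    then obtain D' where D': "D' \<in> sets M" "D' \<subseteq> B" "0 < measure M D'" "measure M D' \<le> measure M B / 2"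
      by blast
    have "measure M D' \<le> measure M A * (1/2)^Suc n" using D'(4) B(4) by simp
    with D' B(2) show ?case by blast
  qed
  moreover obtain n where "(1/2 :: real)^n < \<eta> / measure M A"
    using real_arch_pow_inv[of "\<eta> / measure M A" "1/2"] \<open>0 < \<eta>\<close> A(2) by auto
  then have "measure M A * (1/2)^n \<le> \<eta>" using A(2) by (simp add: field_simps)
  ultimately show ?thesis by (meson order_trans)
qed

text \<open>
  Sierpinski's theorem on the range of an atomless measure. Starting from the empty set, greedily add sets that
  are at least half as large as the allowance \<open>c\<close> permits. The increments tend to \<open>0\<close>; if the union fell
  short of \<open>c\<close>, a small positive set would remain available at every step and keep
  the increments away from \<open>0\<close>.
\<close>

lemma (in finite_measure) subset_of_given_measure:
  assumes split: "\<And>A. A \<in> sets M \<Longrightarrow> 0 < measure M A \<Longrightarrow>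
      \<exists>B\<in>sets M. B \<subseteq> A \<and> 0 < measure M B \<and> 0 < measure M (A - B)"
    and A: "A \<in> sets M" and c: "0 \<le> c" "c \<le> measure M A"
  shows "\<exists>B\<in>sets M. B \<subseteq> A \<and> measure M B = c"
proof -
  \<comment> \<open>The sets that may still be added to \<open>S\<close>.\<close>
  define room where "room S = {B \<in> sets M. B \<subseteq> A - S \<and> measure M S + measure M B \<le> c}" for S
  have "\<exists>S. \<forall>n. (S n \<in> sets M \<and> S n \<subseteq> A \<and> measure M (S n) \<le> c) \<and>
    (S n \<subseteq> S (Suc n) \<and> (\<forall>B\<in>room (S n). measure M B \<le> 2 * (measure M (S (Suc n)) - measure M (S n))))"
  proof (rule dependent_nat_choice)
    show "\<exists>S. S \<in> sets M \<and> S \<subseteq> A \<and> measure M S \<le> c"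
      using c by (intro exI[of _ "{}"]) auto
  next
    fix S and n :: nat assume S: "S \<in> sets M \<and> S \<subseteq> A \<and> measure M S \<le> c"
    define s where "s = Sup (measure M ` room S)"
    have empty: "{} \<in> room S" using S by (simp add: room_def)
    have bdd: "bdd_above (measure M ` room S)"
      unfolding room_def by (intro bdd_aboveI[of _ "c - measure M S"]) auto
    have le_s: "measure M B \<le> s" if "B \<in> room S" for B
      unfolding s_def using that bdd by (intro cSup_upper) auto
    have "\<exists>B\<in>room S. s \<le> 2 * measure M B"
    proof (cases "s \<le> 0")
      case True
      then show ?thesis using empty by (intro bexI[of _ "{}"]) auto
    next
      case False
      then have "s / 2 < s" by simp
      then show ?thesis
        using less_cSup_iff[of "measure M ` room S" "s / 2"] empty bdd unfolding s_def[symmetric] by force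
    qed
    then obtain B where B: "B \<in> room S" "s \<le> 2 * measure M B" by blast
    then have B': "B \<in> sets M" "B \<subseteq> A - S" "measure M S + measure M B \<le> c" by (auto simp: room_def)
    have "measure M (S \<union> B) = measure M S + measure M B"
      using S B' by (intro finite_measure_Union) auto
    then show "\<exists>S'. (S' \<in> sets M \<and> S' \<subseteq> A \<and> measure M S' \<le> c) \<and>
      (S \<subseteq> S' \<and> (\<forall>B\<in>room S. measure M B \<le> 2 * (measure M S' - measure M S)))"
      using S B' B(2) le_s by (intro exI[of _ "S \<union> B"]) (force intro: order_trans)
  qed
  then obtain S where S: "\<And>n. S n \<in> sets M" "\<And>n. S n \<subseteq> A" "\<And>n. measure M (S n) \<le> c"
    and inc: "\<And>n. S n \<subseteq> S (Suc n)"
    and greedy: "\<And>n B. B \<in> room (S n) \<Longrightarrow> measure M B \<le> 2 * (measure M (S (Suc n)) - measure M (S n))"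
    by blast
  define T where "T = (\<Union>n. S n)"
  have T: "T \<in> sets M" "T \<subseteq> A" unfolding T_def using S by auto
  have lim: "(\<lambda>n. measure M (S n)) \<longlonglongrightarrow> measure M T"
    unfolding T_def using S(1) by (intro finite_Lim_measure_incseq incseq_SucI inc) auto
  have le: "measure M T \<le> c" by (rule LIMSEQ_le_const2[OF lim]) (auto simp: S)
  have "measure M T = c"
  proof (rule ccontr)
    assume "measure M T \<noteq> c"
    with le have less: "measure M T < c" by simp
    have "measure M (A - T) = measure M A - measure M T" by (intro finite_measure_Diff A T)
    then have "0 < measure M (A - T)" using less c by simp
    then obtain B where B: "B \<in> sets M" "B \<subseteq> A - T" "0 < measure M B" "measure M B \<le> c - measure M T"
      using small_positive_subset[OF split, of "A - T" "c - measure M T"] A T less by auto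
    have "B \<in> room (S n)" for n
    proof -
      have "measure M (S n) \<le> measure M T"
        using T(1) by (intro finite_measure_mono) (auto simp: T_def)
      then show ?thesis using B by (auto simp: room_def T_def)
    qed
    then have "measure M B \<le> 2 * (measure M (S (Suc n)) - measure M (S n))" for n by (rule greedy)
    moreover have "(\<lambda>n. 2 * (measure M (S (Suc n)) - measure M (S n))) \<longlonglongrightarrow> 2 * (measure M T - measure M T)"
      by (intro tendsto_intros lim LIMSEQ_Suc)
    ultimately have "measure M B \<le> 2 * (measure M T - measure M T)"
      by (intro LIMSEQ_le_const) auto
    with B(3) show False by simp
  qed
  with T show ?thesis by blast
qed

text \<open>
  Atomlessness passes to densities, so integrals over subsets take all intermediate values.
\<close>

lemma atomless_subset_of_given_integral:
  fixes \<Phi> :: "'w \<Rightarrow> real"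
  assumes "atomless M" and \<Phi>: "integrable M \<Phi>" "\<And>w. 0 \<le> \<Phi> w"
    and A: "A \<in> sets M" and c: "0 \<le> c" "c \<le> (LINT w|M. indicator A w * \<Phi> w)"
  obtains B where "B \<in> sets M" "B \<subseteq> A" "(LINT w|M. indicator B w * \<Phi> w) = c"
proof -
  have [measurable]: "\<Phi> \<in> borel_measurable M" using \<Phi>(1) by (rule borel_measurable_integrable)
  define D where "D = density M (\<lambda>w. ennreal (\<Phi> w))"
  have int: "integrable M (\<lambda>w. indicator B w * \<Phi> w)" if "B \<in> sets M" for B
    using integrable_mult_indicator[OF that \<Phi>(1)] by simp
  have eD: "emeasure D B = ennreal (LINT w|M. indicator B w * \<Phi> w)" if "B \<in> sets M" for B
  proof -
    have "emeasure D B = (\<integral>\<^sup>+w. ennreal (indicator B w * \<Phi> w) \<partial>M)"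
      unfolding D_def using that by (subst emeasure_density) (auto intro!: nn_integral_cong simp: indicator_def)
    then show ?thesis using int[OF that] \<Phi>(2) by (subst (asm) nn_integral_eq_integral) auto
  qed
  have mD: "measure D B = (LINT w|M. indicator B w * \<Phi> w)" if "B \<in> sets M" for B
    unfolding measure_def eD[OF that] using \<Phi>(2) by (simp add: integral_nonneg_AE)
  have sD: "sets D = sets M" by (simp add: D_def)
  have "emeasure D (space D) = ennreal (LINT w|M. indicator (space M) w * \<Phi> w)"
    using eD[of "space M"] by (simp add: D_def)
  then interpret D: finite_measure D by (intro finite_measureI) simp
  have zero: "measure D B = 0 \<longleftrightarrow> emeasure M (B \<inter> {w\<in>space M. 0 < \<Phi> w}) = 0" if "B \<in> sets M" for B
  proof -
    have "measure D B = 0 \<longleftrightarrow> (AE w in M. indicator B w * \<Phi> w = 0)"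
      unfolding mD[OF that] using int[OF that] \<Phi>(2) by (intro integral_nonneg_eq_0_iff_AE) auto
    also have "\<dots> \<longleftrightarrow> (AE w in M. w \<notin> B \<inter> {w\<in>space M. 0 < \<Phi> w})"
      using \<Phi>(2) by (intro AE_cong) (auto simp: indicator_def less_le)
    also have "\<dots> \<longleftrightarrow> emeasure M (B \<inter> {w\<in>space M. 0 < \<Phi> w}) = 0"
      using that by (subst AE_iff_null_sets[symmetric]) (auto simp: null_sets_def)
    finally show ?thesis .
  qed
  have "\<exists>B\<in>sets D. B \<subseteq> A \<and> 0 < measure D B \<and> 0 < measure D (A - B)"
    if A: "A \<in> sets D" "0 < measure D A" for A
  proof -
    let ?P = "{w\<in>space M. 0 < \<Phi> w}"
    have AM: "A \<in> sets M" using A sD by simp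
    have "emeasure M (A \<inter> ?P) \<noteq> 0" using zero[OF AM] A(2) by simp
    then have "0 < emeasure M (A \<inter> ?P)" by (simp add: zero_less_iff_neq_zero)
    moreover have AP: "A \<inter> ?P \<in> sets M" using AM by simp
    moreover have "\<not> atom M (A \<inter> ?P)" using \<open>atomless M\<close> by (auto simp: atomless_def)
    ultimately obtain B where B: "B \<in> sets M" "B \<subseteq> A \<inter> ?P" "emeasure M B \<noteq> 0"
      "emeasure M (A \<inter> ?P - B) \<noteq> 0" unfolding atom_def by blast
    have "B \<inter> ?P = B" "(A - B) \<inter> ?P = A \<inter> ?P - B" using B(2) by auto
    then have "measure D B \<noteq> 0" "measure D (A - B) \<noteq> 0"
      using B zero[of B] zero[of "A - B"] AM by auto
    then show ?thesis using B sD by (intro bexI[of _ B]) (auto simp: zero_less_measure_iff)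
  qed
  then obtain B where "B \<in> sets D" "B \<subseteq> A" "measure D B = c"
    using D.subset_of_given_measure[of A c] A c mD[OF A] sD by auto
  then show ?thesis using that mD sD by auto
qed

section \<open>Joint measurability\<close>

text \<open>
  A scalarly measurable functional is a Caratheodory integrand: approximating \<open>e\<close> by simple functions
  of \<open>e\<close> exhibits it as a limit of functions that are measurable on countably many rectangles.
\<close>

lemma borel_measurable_blinfun_pairing:
  fixes xs :: "'w \<Rightarrow> ('e::{real_normed_vector, second_countable_topology} \<Rightarrow>\<^sub>L real)"
  assumes xs: "\<And>e. (\<lambda>w. blinfun_apply (xs w) e) \<in> borel_measurable M"
  shows "(\<lambda>p. blinfun_apply (xs (fst p)) (snd p)) \<in> borel_measurable (M \<Otimes>\<^sub>M borel)"
proof -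
  obtain s :: "nat \<Rightarrow> 'e \<Rightarrow> 'e" where s: "\<And>i. simple_function borel (s i)" "\<And>e. (\<lambda>i. s i e) \<longlonglongrightarrow> e"
    using borel_measurable_implies_sequence_metric[of "\<lambda>e :: 'e. e" borel 0] by auto
  show ?thesis
  proof (rule borel_measurable_LIMSEQ_real)
    fix i
    have fin: "finite (range (s i))" using simple_functionD(1)[OF s(1)[of i]] by simp
    have "s i \<in> measurable borel (count_space (range (s i)))"
      using fin simple_functionD(2)[OF s(1)[of i]] by (subst measurable_count_space_eq2) auto
    then have "(\<lambda>p. s i (snd p)) \<in> measurable (M \<Otimes>\<^sub>M borel) (count_space (range (s i)))"
      by (rule measurable_compose[OF measurable_snd])
    then show "(\<lambda>p. blinfun_apply (xs (fst p)) (s i (snd p))) \<in> borel_measurable (M \<Otimes>\<^sub>M borel)"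
      using measurable_compose[OF measurable_fst xs] countable_finite[OF fin]
      by (intro measurable_compose_countable'[where f = "\<lambda>e p. blinfun_apply (xs (fst p)) e"
            and g = "\<lambda>p. s i (snd p)" and I = "range (s i)"])
  next
    fix p show "(\<lambda>i. blinfun_apply (xs (fst p)) (s i (snd p))) \<longlonglongrightarrow> blinfun_apply (xs (fst p)) (snd p)"
      by (rule blinfun.tendsto[OF tendsto_const s(2)])
  qed
qed

lemma measurable_integrand_compose:
  assumes "measurable_integrand M f" "x \<in> borel_measurable M"
  shows "(\<lambda>w. f w (x w)) \<in> borel_measurable M"
  using measurable_compose[OF measurable_Pair[OF measurable_ident_sets[OF refl] assms(2)]
      assms(1)[unfolded measurable_integrand_def]] by simp

lemma measurable_integrand_quotient:
  fixes f :: "'w \<Rightarrow> 'e::{real_normed_vector, second_countable_topology} \<Rightarrow> ereal"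
  assumes f: "measurable_integrand M f" and x0: "x0 \<in> borel_measurable M"
    and xs: "\<And>e. (\<lambda>w. blinfun_apply (xs w) e) \<in> borel_measurable M"
  shows "measurable_integrand M (quotient_integrand f xs x0 r)"
proof -
  have "(\<lambda>p. (fst p, x0 (fst p) + r *\<^sub>R snd p)) \<in> measurable (M \<Otimes>\<^sub>M borel) (M \<Otimes>\<^sub>M borel)"
    using measurable_compose[OF measurable_fst x0]
    by (intro measurable_Pair measurable_fst borel_measurable_add borel_measurable_scaleR) auto
  from measurable_compose[OF this f[unfolded measurable_integrand_def]]
  have [measurable]: "(\<lambda>p. f (fst p) (x0 (fst p) + r *\<^sub>R snd p)) \<in> borel_measurable (M \<Otimes>\<^sub>M borel)" by simp
  have [measurable]: "(\<lambda>p. f (fst p) (x0 (fst p))) \<in> borel_measurable (M \<Otimes>\<^sub>M borel)"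
    using measurable_compose[OF measurable_fst measurable_integrand_compose[OF f x0]] .
  note [measurable] = borel_measurable_blinfun_pairing[OF xs]
  show ?thesis
    unfolding measurable_integrand_def quotient_integrand_def case_prod_unfold by measurable
qed

section \<open>Deficits of an integrand along measurable selections\<close>

text \<open>
  The amounts by which \<open>g\<close> falls below \<open>- \<epsilon> \<phi>\<close> along measurable selections. On the support of
  \<open>k\<close> the value of \<open>\<phi>\<close> is required to be finite, which makes the inequality one between real numbers
  except for a possible \<open>g = -\<infinity>\<close>.
\<close>

definition deficits :: "'w measure \<Rightarrow> ('w \<Rightarrow> 'e::topological_space \<Rightarrow> ereal)
    \<Rightarrow> ('w \<Rightarrow> 'e \<Rightarrow> ereal) \<Rightarrow> real \<Rightarrow> ('w \<Rightarrow> ennreal) set" where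
  "deficits M g \<phi> \<epsilon> = {k \<in> borel_measurable M. \<exists>x\<in>borel_measurable M. \<forall>w\<in>space M.
     k w < \<infinity> \<and> (0 < k w \<longrightarrow>
       (\<exists>p. \<phi> w (x w) = ereal p \<and> g w (x w) \<le> ereal (- (\<epsilon> * p) - enn2real (k w))))}"

lemma zero_in_deficits: "(\<lambda>w. 0) \<in> deficits M g \<phi> \<epsilon>"
  unfolding deficits_def by (intro CollectI conjI bexI[of _ "\<lambda>_. undefined"]) simp_all

lemma deficits_max:
  assumes "h \<in> deficits M g \<phi> \<epsilon>" "k \<in> deficits M g \<phi> \<epsilon>"
  shows "(\<lambda>w. max (h w) (k w)) \<in> deficits M g \<phi> \<epsilon>"
proof -
  obtain x where h[measurable]: "h \<in> borel_measurable M" and x[measurable]: "x \<in> borel_measurable M"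
    and hx: "\<And>w. w \<in> space M \<Longrightarrow> h w < \<infinity> \<and> (0 < h w \<longrightarrow>
      (\<exists>p. \<phi> w (x w) = ereal p \<and> g w (x w) \<le> ereal (- (\<epsilon> * p) - enn2real (h w))))"
    using assms(1) unfolding deficits_def by blast
  obtain y where k[measurable]: "k \<in> borel_measurable M" and y[measurable]: "y \<in> borel_measurable M"
    and ky: "\<And>w. w \<in> space M \<Longrightarrow> k w < \<infinity> \<and> (0 < k w \<longrightarrow>
      (\<exists>p. \<phi> w (y w) = ereal p \<and> g w (y w) \<le> ereal (- (\<epsilon> * p) - enn2real (k w))))"
    using assms(2) unfolding deficits_def by blast
  define z where "z w = (if h w \<le> k w then y w else x w)" for w
  have "z \<in> borel_measurable M" unfolding z_def by measurable
  moreover have "max (h w) (k w) < \<infinity> \<and> (0 < max (h w) (k w) \<longrightarrow>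
      (\<exists>p. \<phi> w (z w) = ereal p \<and> g w (z w) \<le> ereal (- (\<epsilon> * p) - enn2real (max (h w) (k w)))))"
    if "w \<in> space M" for w
    using hx[OF that] ky[OF that] by (cases "h w \<le> k w") (simp_all add: z_def max_def)
  moreover have "(\<lambda>w. max (h w) (k w)) \<in> borel_measurable M" by measurable
  ultimately show ?thesis unfolding deficits_def by blast
qed

text \<open>
  The essential supremum \<open>u\<close> of the deficits bounds \<open>- \<epsilon> \<phi> - g\<close> along every selection for almost
  every \<open>\<omega>\<close>. Measurable selection lets the exceptional null set be chosen
  independently of the selection, which gives the inequality for all \<open>e\<close> at once.
\<close>

lemma integrand_ge_of_bounded_deficits:
  fixes g \<phi> :: "'w \<Rightarrow> 'e::{complete_space, second_countable_topology} \<Rightarrow> ereal"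
  assumes "sigma_finite_measure M" and g: "measurable_integrand M g" and \<phi>: "measurable_integrand M \<phi>"
    and \<phi>_nonneg: "\<And>w e. w \<in> space M \<Longrightarrow> 0 \<le> \<phi> w e" and "0 < \<epsilon>"
    and fin: "(SUP k\<in>deficits M g \<phi> \<epsilon>. \<integral>\<^sup>+w. k w \<partial>M) < \<infinity>"
  obtains u :: "'w \<Rightarrow> real" where "\<And>w. 0 \<le> u w" "integrable M u"
    "ennreal (integral\<^sup>L M u) \<le> (SUP k\<in>deficits M g \<phi> \<epsilon>. \<integral>\<^sup>+w. k w \<partial>M)"
    "integrand_ge M g (\<lambda>w e. - ereal \<epsilon> * \<phi> w e - ereal (u w))"
proof -
  let ?H = "deficits M g \<phi> \<epsilon>"
  have sub: "?H \<subseteq> borel_measurable M" by (auto simp: deficits_def)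
  have ne: "?H \<noteq> {}" using zero_in_deficits by blast
  obtain U where U[measurable]: "U \<in> borel_measurable M"
    and U_int: "(\<integral>\<^sup>+w. U w \<partial>M) = (SUP k\<in>?H. \<integral>\<^sup>+w. k w \<partial>M)"
    and U_ge: "\<And>k. k \<in> ?H \<Longrightarrow> AE w in M. k w \<le> U w"
    using essential_supremum_of_max_closed_family[OF sub ne deficits_max fin] by blast
  define u where "u w = enn2real (U w)" for w
  have u[measurable]: "u \<in> borel_measurable M" unfolding u_def by measurable
  have "(\<integral>\<^sup>+w. U w \<partial>M) \<noteq> \<infinity>" unfolding U_int using fin by (rule less_imp_neq)
  then have "AE w in M. U w \<noteq> \<infinity>" by (rule nn_integral_PInf_AE[OF U])
  then have uU: "AE w in M. ennreal (u w) = U w"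
    by eventually_elim (simp add: u_def less_top)
  have u_int: "(\<integral>\<^sup>+w. ennreal (u w) \<partial>M) = (SUP k\<in>?H. \<integral>\<^sup>+w. k w \<partial>M)"
    unfolding U_int[symmetric] by (intro nn_integral_cong_AE uU)
  have u_nonneg: "0 \<le> u w" for w by (simp add: u_def)
  have u_integrable: "integrable M u"
    by (intro integrableI_nonneg u AE_I2 u_nonneg) (simp only: u_int fin)
  have u_le: "ennreal (integral\<^sup>L M u) \<le> (SUP k\<in>?H. \<integral>\<^sup>+w. k w \<partial>M)"
    using u_int u_integrable u_nonneg by (simp add: nn_integral_eq_integral)
  define G where "G = {p \<in> space (M \<Otimes>\<^sub>M borel).
    g (fst p) (snd p) < - ereal \<epsilon> * \<phi> (fst p) (snd p) - ereal (u (fst p))}"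
  have [measurable]: "(\<lambda>p. g (fst p) (snd p)) \<in> borel_measurable (M \<Otimes>\<^sub>M borel)"
    "(\<lambda>p. \<phi> (fst p) (snd p)) \<in> borel_measurable (M \<Otimes>\<^sub>M borel)"
    using g \<phi> unfolding measurable_integrand_def case_prod_unfold by auto
  have G: "G \<in> sets (M \<Otimes>\<^sub>M borel)" unfolding G_def by measurable
  have "AE w in M. (w, x w) \<notin> G" if x[measurable]: "x \<in> borel_measurable M" for x
  proof -
    have [measurable]: "(\<lambda>w. g w (x w)) \<in> borel_measurable M" "(\<lambda>w. \<phi> w (x w)) \<in> borel_measurable M"
      by (rule measurable_integrand_compose[OF g x], rule measurable_integrand_compose[OF \<phi> x])
    define A where "A = {w\<in>space M. g w (x w) < - ereal \<epsilon> * \<phi> w (x w) - ereal (u w)}"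
    have [measurable]: "A \<in> sets M" unfolding A_def by measurable
    have A_eq: "A = {w\<in>space M. (w, x w) \<in> G}" by (auto simp: A_def G_def space_pair_measure)
    \<comment> \<open>The gap is capped at \<open>u + 1\<close> because \<open>g\<close> may be \<open>-\<infinity>\<close>.\<close>
    define m where "m w = real_of_ereal (min (ereal (u w + 1)) (- ereal \<epsilon> * \<phi> w (x w) - g w (x w)))" for w
    have m: "u w < m w \<and> (\<exists>p. \<phi> w (x w) = ereal p \<and> g w (x w) \<le> ereal (- (\<epsilon> * p) - m w))"
      if "w \<in> A" for w
    proof -
      have w: "w \<in> space M" "g w (x w) < - ereal \<epsilon> * \<phi> w (x w) - ereal (u w)"
        using that by (auto simp: A_def)
      obtain p where p: "\<phi> w (x w) = ereal p"
        using w \<phi>_nonneg[OF w(1), of "x w"] \<open>0 < \<epsilon>\<close> by (cases "\<phi> w (x w)") auto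
      show ?thesis
        using w(2) p by (cases "g w (x w)") (auto simp: m_def min_def)
    qed
    define k where "k w = (if w \<in> A then ennreal (m w) else 0)" for w
    have "m \<in> borel_measurable M" unfolding m_def by measurable
    then have "k \<in> borel_measurable M" unfolding k_def by measurable
    moreover have "k w < \<infinity> \<and> (0 < k w \<longrightarrow>
       (\<exists>p. \<phi> w (x w) = ereal p \<and> g w (x w) \<le> ereal (- (\<epsilon> * p) - enn2real (k w))))" for w
      using m[of w] u_nonneg[of w] by (auto simp: k_def)
    ultimately have "k \<in> ?H" unfolding deficits_def using x by blast
    from U_ge[OF this] uU show ?thesis
    proof eventually_elim
      case (elim w)
      have "w \<notin> A"
      proof
        assume "w \<in> A"
        then have "ennreal (m w) \<le> ennreal (u w)" using elim by (simp add: k_def)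
        then show False using m[OF \<open>w \<in> A\<close>] u_nonneg[of w] by (simp add: ennreal_le_iff)
      qed
      then show ?case by (auto simp: A_eq G_def space_pair_measure)
    qed
  qed
  then have "AE w in M. \<forall>e. (w, e) \<notin> G"
    by (rule AE_sections_empty_if_no_selection[OF assms(1) G])
  then obtain Z where "Z \<in> null_sets M" "{w\<in>space M. \<not> (\<forall>e. (w, e) \<notin> G)} \<subseteq> Z"
    unfolding eventually_ae_filter by blast
  then have "integrand_ge M g (\<lambda>w e. - ereal \<epsilon> * \<phi> w e - ereal (u w))"
    unfolding integrand_ge_def by (intro bexI[of _ Z]) (force simp: G_def space_pair_measure not_less)+
  with u_nonneg u_integrable u_le show ?thesis by (rule that)
qed

text \<open>
  The heart of the converse. A deficit of integral above \<open>\<delta>\<close> can be truncated to a set \<open>A\<close> on which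
  everything is bounded, so that its selection \<open>x\<close> restricted to \<open>A\<close> lies in \<open>X\<close>. If the integral
  of \<open>\<phi>\<close> along it exceeds \<open>1\<close>, atomlessness allows \<open>A\<close> to be cut down until this integral
  is exactly \<open>1\<close>; the term \<open>- \<epsilon> \<phi>\<close> alone then contributes \<open>- \<epsilon>\<close>. Either way \<open>g\<close> has integral at
  most \<open>- min \<delta> \<epsilon>\<close> along a function in the sublevel set of \<open>\<phi>\<close>.
\<close>

lemma deficits_nn_integral_le:
  fixes g \<phi> :: "'w \<Rightarrow> 'e::{banach, second_countable_topology} \<Rightarrow> ereal"
  assumes "sigma_finite_measure M" "atomless M"
    and g: "measurable_integrand M g" and \<phi>: "measurable_integrand M \<phi>"
    and \<phi>_nonneg: "\<And>w e. w \<in> space M \<Longrightarrow> 0 \<le> \<phi> w e" and \<phi>_0: "\<And>w. w \<in> space M \<Longrightarrow> \<phi> w 0 = 0"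
    and g_0: "AE w in M. g w 0 \<le> 0"
    and \<epsilon>: "0 < \<epsilon>" and \<delta>: "0 < \<delta>"
    and \<Omega>: "\<And>n. \<Omega> n \<in> sets M" "incseq \<Omega>" "(\<Union>n. \<Omega> n) = space M"
    and X: "\<And>n y. y \<in> Linfty M \<Longrightarrow> (\<lambda>w. indicator (\<Omega> n) w *\<^sub>R y w) \<in> X"
    and lower: "\<And>x v. x \<in> X \<Longrightarrow> integral_functional M \<phi> x \<le> 1 \<Longrightarrow> integrable M v \<Longrightarrow>
      AE w in M. g w (x w) \<le> ereal (v w) \<Longrightarrow> - min \<delta> \<epsilon> < integral\<^sup>L M v"
    and k: "k \<in> deficits M g \<phi> \<epsilon>"
  shows "(\<integral>\<^sup>+w. k w \<partial>M) \<le> ennreal \<delta>"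
proof (rule ccontr)
  assume "\<not> (\<integral>\<^sup>+w. k w \<partial>M) \<le> ennreal \<delta>"
  then have large: "ennreal \<delta> < (\<integral>\<^sup>+w. k w \<partial>M)" by simp
  interpret sigma_finite_measure M by fact
  obtain x where k_meas[measurable]: "k \<in> borel_measurable M" and x[measurable]: "x \<in> borel_measurable M"
    and kx: "\<And>w. w \<in> space M \<Longrightarrow> k w < \<infinity> \<and> (0 < k w \<longrightarrow>
      (\<exists>p. \<phi> w (x w) = ereal p \<and> g w (x w) \<le> ereal (- (\<epsilon> * p) - enn2real (k w))))"
    using k unfolding deficits_def by blast
  obtain F :: "nat \<Rightarrow> 'w set" where F: "range F \<subseteq> sets M" "(\<Union>i. F i) = space M"
    "\<And>i. emeasure M (F i) \<noteq> \<infinity>" "incseq F"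
    by (rule sigma_finite_incseq) blast
  have [measurable]: "F n \<in> sets M" "\<Omega> n \<in> sets M" for n using F(1) \<Omega> by auto
  have [measurable]: "(\<lambda>w. \<phi> w (x w)) \<in> borel_measurable M"
    by (rule measurable_integrand_compose[OF \<phi> x])
  define p where "p w = real_of_ereal (\<phi> w (x w))" for w
  define q where "q w = enn2real (k w)" for w
  define B where "B n = {w\<in>space M. w \<in> \<Omega> n \<and> w \<in> F n \<and> 0 < k w \<and>
    norm (x w) \<le> real n \<and> p w \<le> real n \<and> q w \<le> real n}" for n
  have p_meas[measurable]: "p \<in> borel_measurable M" and q_meas[measurable]: "q \<in> borel_measurable M"
    unfolding p_def q_def by measurable
  have B_sets[measurable]: "B n \<in> sets M" for n unfolding B_def by measurable
  have pq_nonneg: "0 \<le> p w" "0 \<le> q w" if "w \<in> space M" for w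
    using \<phi>_nonneg[OF that] by (auto simp: p_def q_def real_of_ereal_pos)
  have B_value: "\<phi> w (x w) = ereal (p w)" "g w (x w) \<le> ereal (- (\<epsilon> * p w) - q w)" "k w = ennreal (q w)"
    if "w \<in> B n" for w n
    using that kx[of w] by (auto simp: B_def p_def q_def less_top)
  have B_inc: "incseq B"
  proof (rule monoI, rule subsetI)
    fix m n w assume "m \<le> n" "w \<in> B m"
    then show "w \<in> B n"
      using incseqD[OF \<Omega>(2), of m n] incseqD[OF F(4), of m n] by (auto simp: B_def)
  qed
  have B_Un: "(\<Union>n. B n) = {w\<in>space M. 0 < k w}"
  proof (intro set_eqI iffI)
    fix w assume "w \<in> {w\<in>space M. 0 < k w}"
    then have w: "w \<in> space M" "0 < k w" by auto
    obtain i j where ij: "w \<in> \<Omega> i" "w \<in> F j" using w \<Omega>(3) F(2) by blast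
    obtain l where l: "max (norm (x w)) (max (p w) (q w)) \<le> real l" using real_arch_simple by blast
    let ?n = "max i (max j l)"
    have "w \<in> \<Omega> ?n" "w \<in> F ?n"
      using ij incseqD[OF \<Omega>(2), of i ?n] incseqD[OF F(4), of j ?n] by (auto simp: le_max_iff_disj)
    then have "w \<in> B ?n" using w l by (auto simp: B_def)
    then show "w \<in> (\<Union>n. B n)" by blast
  qed (auto simp: B_def)
  have "(\<integral>\<^sup>+w. k w \<partial>M) = emeasure (density M k) (\<Union>n. B n)"
    unfolding B_Un by (subst emeasure_density) (auto intro!: nn_integral_cong simp: indicator_def zero_less_iff_neq_zero)
  also have "\<dots> = (SUP n. emeasure (density M k) (B n))"
    using B_inc by (intro SUP_emeasure_incseq[symmetric]) auto
  finally have "ennreal \<delta> < (SUP n. emeasure (density M k) (B n))" using large by simp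
  then obtain n where n: "ennreal \<delta> < emeasure (density M k) (B n)"
    unfolding less_SUP_iff by blast
  define A where "A = B n"
  have A[measurable]: "A \<in> sets M" by (simp add: A_def)
  have A_space: "A \<subseteq> space M" by (auto simp: A_def B_def)
  have "emeasure M A \<le> emeasure M (F n)" by (intro emeasure_mono) (auto simp: A_def B_def)
  also have "\<dots> < \<infinity>" using F(3)[of n] by (simp add: less_top[symmetric])
  finally have A_fin: "emeasure M A < \<infinity>" .
  have ind_int: "integrable M (\<lambda>w. indicator S w * p w)" "integrable M (\<lambda>w. indicator S w * q w)"
    if "S \<in> sets M" "S \<subseteq> A" for S
  proof -
    have S_fin: "emeasure M S < \<infinity>"
      using emeasure_mono[OF that(2) A] A_fin by (rule order_le_less_trans)
    have "AE w in M. w \<in> S \<longrightarrow> norm (p w) \<le> real n" "AE w in M. w \<in> S \<longrightarrow> norm (q w) \<le> real n"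
      using that(2) pq_nonneg by (auto simp: A_def B_def)
    then show "integrable M (\<lambda>w. indicator S w * p w)" "integrable M (\<lambda>w. indicator S w * q w)"
      using integrableI_bounded_set_indicator[OF that(1) p_meas S_fin]
        integrableI_bounded_set_indicator[OF that(1) q_meas S_fin] by simp_all
  qed
  have "emeasure (density M k) A = (\<integral>\<^sup>+w. ennreal (indicator A w * q w) \<partial>M)"
    using A B_value(3) by (subst emeasure_density) (auto intro!: nn_integral_cong simp: indicator_def A_def)
  also have "\<dots> = ennreal (LINT w|M. indicator A w * q w)"
    using ind_int(2)[OF A order_refl] A_space pq_nonneg
    by (intro nn_integral_eq_integral) (auto simp: indicator_def)
  finally have q_large: "\<delta> < (LINT w|M. indicator A w * q w)"
    using n \<delta> unfolding A_def[symmetric] by (simp add: ennreal_less_iff)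
  \<comment> \<open>Cut \<open>A\<close> down only if the integral of \<open>\<phi>\<close> is too large.\<close>
  obtain S where S: "S \<in> sets M" "S \<subseteq> A" "(LINT w|M. indicator S w * p w) \<le> 1"
    and S_alt: "S = A \<or> (LINT w|M. indicator S w * p w) = 1"
  proof (cases "(LINT w|M. indicator A w * p w) \<le> 1")
    case True
    then show ?thesis using that A by blast
  next
    case False
    have int: "integrable M (\<lambda>w. indicator A w * p w)" by (rule ind_int[OF A order_refl])
    have nonneg: "0 \<le> indicator A w * p w" for w using A_space pq_nonneg by (auto simp: indicator_def)
    have eq: "(LINT w|M. indicator T w * (indicator A w * p w)) = (LINT w|M. indicator T w * p w)"
      if "T \<subseteq> A" for T
      using that by (intro Bochner_Integration.integral_cong) (auto simp: indicator_def)
    have "1 \<le> (LINT w|M. indicator A w * (indicator A w * p w))"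
      unfolding eq[OF order_refl] using False by simp
    then obtain S where S: "S \<in> sets M" "S \<subseteq> A" "(LINT w|M. indicator S w * (indicator A w * p w)) = 1"
      using atomless_subset_of_given_integral[OF \<open>atomless M\<close> int nonneg A zero_le_one] by blast
    then show ?thesis using that[of S] eq[of S] by simp
  qed
  define y where "y w = indicator S w *\<^sub>R x w" for w
  have "y \<in> Linfty M"
    unfolding Linfty_def
  proof (intro CollectI conjI exI[of _ "real n"] AE_I2)
    show "y \<in> borel_measurable M" unfolding y_def using S(1) by measurable
    show "norm (y w) \<le> real n" for w using S(2) by (auto simp: y_def indicator_def A_def B_def)
  qed
  then have "(\<lambda>w. indicator (\<Omega> n) w *\<^sub>R y w) \<in> X" by (rule X)
  moreover have "indicator (\<Omega> n) w *\<^sub>R y w = y w" for w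
    using S(2) by (auto simp: y_def indicator_def A_def B_def)
  ultimately have yX: "y \<in> X" by simp
  have "integral_functional M \<phi> y \<le> ereal (LINT w|M. indicator S w * p w)"
    unfolding integral_functional_def
  proof (intro upper_integral_le ind_int S AE_I2)
    fix w assume "w \<in> space M"
    then show "\<phi> w (y w) \<le> ereal (indicator S w * p w)"
      using S(2) B_value(1)[of w n] \<phi>_0[of w] by (auto simp: y_def indicator_def A_def)
  qed
  then have "integral_functional M \<phi> y \<le> 1" using S(3) by (simp add: order_trans one_ereal_def)
  moreover define v where "v w = - (\<epsilon> * (indicator S w * p w)) - indicator S w * q w" for w
  moreover have "integrable M v" unfolding v_def using ind_int[OF S(1,2)] by simp
  moreover have "AE w in M. g w (y w) \<le> ereal (v w)"
    using g_0
  proof eventually_elim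
    case (elim w)
    show ?case
    proof (cases "w \<in> S")
      case True
      then show ?thesis using B_value(2)[of w n] S(2) by (auto simp: v_def y_def A_def)
    next
      case False
      then show ?thesis using elim by (simp add: v_def y_def zero_ereal_def)
    qed
  qed
  ultimately have "- min \<delta> \<epsilon> < integral\<^sup>L M v" using lower[OF yX] by blast
  also have "integral\<^sup>L M v = - (\<epsilon> * (LINT w|M. indicator S w * p w)) - (LINT w|M. indicator S w * q w)"
    unfolding v_def using ind_int[OF S(1,2)] by simp
  finally have v_lower: "\<epsilon> * (LINT w|M. indicator S w * p w) + (LINT w|M. indicator S w * q w) < min \<delta> \<epsilon>" by linarith
  have nonneg: "0 \<le> (LINT w|M. indicator S w * p w)" "0 \<le> (LINT w|M. indicator S w * q w)"
    using S(2) A_space pq_nonneg by (auto intro!: Bochner_Integration.integral_nonneg simp: indicator_def)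
  from S_alt show False
  proof
    assume "S = A"
    then show False using v_lower q_large mult_nonneg_nonneg[of \<epsilon>, OF _ nonneg(1)] \<epsilon> by simp
  next
    assume "(LINT w|M. indicator S w * p w) = 1"
    then show False using v_lower nonneg(2) by simp
  qed
qed

section \<open>Subderivatives of integral functionals\<close>

text \<open>
  Difference quotient and integration commute: the subtracted quantities are integrable, hence the
  upper integral passes through them.
\<close>

lemma integral_functional_quotient_integrand:
  assumes a: "integrable M a" "AE w in M. f w (x0 w) = ereal (a w)"
    "integral_functional M f x0 = ereal (integral\<^sup>L M a)"
    and b: "integrable M (\<lambda>w. blinfun_apply (xs w) (x w))" and r: "0 < r"
  shows "integral_functional M (quotient_integrand f xs x0 r) x
    = quotient_functional (integral_functional M f) x0 x r - ereal (pairing M xs x)"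
proof -
  have "integral_functional M (quotient_integrand f xs x0 r) x
    = upper_integral M (\<lambda>w. ereal (inverse r) * (f w (x0 w + r *\<^sub>R x w) - ereal (a w))
        - ereal (blinfun_apply (xs w) (x w)))"
    unfolding integral_functional_def quotient_integrand_def
    using a(2) by (intro upper_integral_cong_AE) (auto elim!: eventually_mono)
  also have "\<dots> = ereal (inverse r) * (upper_integral M (\<lambda>w. f w (x0 w + r *\<^sub>R x w)) - ereal (integral\<^sup>L M a))
      - ereal (LINT w|M. blinfun_apply (xs w) (x w))"
    using r by (intro upper_integral_affine a b) simp
  finally show ?thesis
    unfolding quotient_functional_def pairing_def using a(3) by (simp add: integral_functional_def)
qed

text \<open>
  Integrating the minorization over \<open>x\<close> with \<open>I\<^sub>\<phi>(x) \<le> s\<close> bounds the difference quotient from below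
  by \<open>- \<epsilon> s - \<parallel>u\<^sub>r\<parallel>\<^sub>1\<close>, uniformly in \<open>x\<close>.
\<close>

lemma subderivative_if_integrand_minorization:
  assumes born: "integral_bornology M X I \<phi> \<B>"
    and dual: "in_dual X N (pairing M xs)"
    and b: "\<And>x. x \<in> X \<Longrightarrow> integrable M (\<lambda>w. blinfun_apply (xs w) (x w))"
    and a: "integrable M a" "AE w in M. f w (x0 w) = ereal (a w)"
      "integral_functional M f x0 = ereal (integral\<^sup>L M a)"
    and minor: "integrand_minorization M I \<phi> f xs x0"
  shows "subderivative X N \<B> (integral_functional M f) x0 (pairing M xs)"
  unfolding subderivative_def
proof (intro conjI dual ballI)
  fix B assume "B \<in> \<B>"
  then obtain i s where i: "i \<in> I" and B: "B \<subseteq> {x\<in>X. integral_functional M (\<phi> i) x \<le> ereal s}"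
    using born unfolding integral_bornology_def by auto
  have \<phi>_nonneg: "0 \<le> \<phi> i w e" if "w \<in> space M" for w e
    using born i that unfolding integral_bornology_def by auto
  show "0 \<le> Liminf (at_right 0) (\<lambda>r. INF x\<in>B.
      quotient_functional (integral_functional M f) x0 x r - ereal (pairing M xs x))"
    unfolding le_Liminf_iff
  proof (intro allI impI)
    fix y :: ereal assume "y < 0"
    then obtain z where z: "y < ereal z" "ereal z < 0" using ereal_dense2 by blast
    \<comment> \<open>Half of \<open>- z\<close> is reserved for \<open>\<epsilon> \<phi>\<close>, the other half for \<open>u\<^sub>r\<close>. The level is \<open>\<bar>s\<bar> + 1\<close> because integrable
      majorants of \<open>\<phi>\<close> along \<open>x\<close> reach the upper integral only approximately.\<close>
    define \<epsilon> where "\<epsilon> = - z / (2 * (\<bar>s\<bar> + 1))"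
    have \<epsilon>: "0 < \<epsilon>" using z(2) unfolding \<epsilon>_def by (intro divide_pos_pos) auto
    have \<epsilon>_eq: "\<epsilon> * (\<bar>s\<bar> + 1) = - z / 2"
    proof -
      have "2 * (\<bar>s\<bar> + 1) \<noteq> 0" by (simp add: add_nonneg_eq_0_iff)
      then show ?thesis unfolding \<epsilon>_def by (simp add: divide_simps)
    qed
    obtain u where u_int: "\<forall>\<^sub>F r in at_right 0. integrable M (u r)"
      and u_lim: "((\<lambda>r. LINT w|M. \<bar>u r w\<bar>) \<longlongrightarrow> 0) (at_right 0)"
      and u_ge: "\<forall>\<^sub>F r in at_right 0. integrand_ge M (quotient_integrand f xs x0 r)
             (\<lambda>w e. - ereal \<epsilon> * \<phi> i w e - ereal (u r w))"
      using minor i \<epsilon> unfolding integrand_minorization_def by blast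
    have "\<forall>\<^sub>F r in at_right 0. (LINT w|M. \<bar>u r w\<bar>) < - z / 2"
      using z(2) by (intro order_tendstoD(2)[OF u_lim]) auto
    moreover have "\<forall>\<^sub>F r :: real in at_right 0. 0 < r" by (rule eventually_at_right_less)
    ultimately show "\<forall>\<^sub>F r in at_right 0. y < (INF x\<in>B.
      quotient_functional (integral_functional M f) x0 x r - ereal (pairing M xs x))"
      using u_int u_ge
    proof eventually_elim
      case (elim r)
      have "ereal z \<le> quotient_functional (integral_functional M f) x0 x r - ereal (pairing M xs x)"
        if "x \<in> B" for x
      proof -
        have x: "x \<in> X" "integral_functional M (\<phi> i) x \<le> ereal s" using that B by auto
        have "upper_integral M (\<lambda>w. \<phi> i w (x w)) < ereal (\<bar>s\<bar> + 1)"
          using x(2) unfolding integral_functional_def by (rule order_le_less_trans) simp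
        then obtain h where h: "integrable M h" "AE w in M. \<phi> i w (x w) \<le> ereal (h w)"
          "integral\<^sup>L M h < \<bar>s\<bar> + 1"
          unfolding upper_integral_def INF_less_iff by auto
        obtain Z where Z: "Z \<in> null_sets M" "\<And>w e. w \<in> space M - Z \<Longrightarrow>
          - ereal \<epsilon> * \<phi> i w e - ereal (u r w) \<le> quotient_integrand f xs x0 r w e"
          using elim(4) unfolding integrand_ge_def by blast
        have "ereal z \<le> integral_functional M (quotient_integrand f xs x0 r) x"
          unfolding integral_functional_def le_upper_integral_iff
        proof (intro allI impI)
          fix v assume v: "integrable M v" "AE w in M. quotient_integrand f xs x0 r w (x w) \<le> ereal (v w)"
          have "AE w in M. - (\<epsilon> * h w) - \<bar>u r w\<bar> \<le> v w"
            using v(2) h(2) AE_not_in[OF Z(1)] AE_space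
          proof eventually_elim
            case (elim w)
            have "- ereal \<epsilon> * \<phi> i w (x w) - ereal (u r w) \<le> ereal (v w)"
              using elim Z(2)[of w "x w"] by (auto intro: order_trans)
            moreover obtain p where p: "\<phi> i w (x w) = ereal p"
              using elim(2) \<phi>_nonneg[OF elim(4), of "x w"] by (cases "\<phi> i w (x w)") auto
            ultimately have "- (\<epsilon> * p) - u r w \<le> v w" by simp
            moreover have "\<epsilon> * p \<le> \<epsilon> * h w" using elim(2) p \<epsilon> by simp
            ultimately show ?case by linarith
          qed
          moreover have "integrable M (\<lambda>w. - (\<epsilon> * h w) - \<bar>u r w\<bar>)" using h(1) elim(3) by simp
          ultimately have "(LINT w|M. - (\<epsilon> * h w) - \<bar>u r w\<bar>) \<le> integral\<^sup>L M v"
            using v(1) by (intro integral_mono_AE)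
          moreover have "(LINT w|M. - (\<epsilon> * h w) - \<bar>u r w\<bar>) = - (\<epsilon> * integral\<^sup>L M h) - (LINT w|M. \<bar>u r w\<bar>)"
            using h(1) elim(3) by simp
          moreover have "\<epsilon> * integral\<^sup>L M h \<le> - z / 2"
            unfolding \<epsilon>_eq[symmetric] using h(3) \<epsilon> by simp
          ultimately show "z \<le> integral\<^sup>L M v" using elim(1) by linarith
        qed
        then show ?thesis
          using integral_functional_quotient_integrand[OF a b[OF x(1)] elim(2)] by simp
      qed
      then have "ereal z \<le> (INF x\<in>B.
          quotient_functional (integral_functional M f) x0 x r - ereal (pairing M xs x))"
        by (rule INF_greatest)
      with z(1) show ?case by (rule order_less_le_trans)
    qed
  qed
qed

text \<open>
  Conversely the subderivative inequality on the single sublevel set \<open>{I\<^sub>\<phi> \<le> 1}\<close> makes the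
  deficits of the difference quotient small uniformly over selections, and their
  essential supremum serves as \<open>u\<^sub>r\<close>.
\<close>

lemma integrand_minorization_if_subderivative:
  fixes M :: "'w measure" and f :: "'w \<Rightarrow> 'e::{banach, second_countable_topology} \<Rightarrow> ereal"
  assumes M: "sigma_finite_measure M" "atomless M"
    and \<Omega>: "\<And>n. \<Omega> n \<in> sets M" "incseq \<Omega>" "(\<Union>n. \<Omega> n) = space M"
    and X: "\<And>n y. y \<in> Linfty M \<Longrightarrow> (\<lambda>w. indicator (\<Omega> n) w *\<^sub>R y w) \<in> X"
    and f: "measurable_integrand M f" and \<phi>: "\<And>i. i \<in> I \<Longrightarrow> measurable_integrand M (\<phi> i)"
    and born: "integral_bornology M X I \<phi> \<B>"
    and x0: "x0 \<in> borel_measurable M"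
    and xs: "\<And>e. (\<lambda>w. blinfun_apply (xs w) e) \<in> borel_measurable M"
    and b: "\<And>x. x \<in> X \<Longrightarrow> integrable M (\<lambda>w. blinfun_apply (xs w) (x w))"
    and a: "integrable M a" "AE w in M. f w (x0 w) = ereal (a w)"
      "integral_functional M f x0 = ereal (integral\<^sup>L M a)"
    and sub: "subderivative X N \<B> (integral_functional M f) x0 (pairing M xs)"
  shows "integrand_minorization M I \<phi> f xs x0"
  unfolding integrand_minorization_def
proof (intro ballI allI impI)
  fix i and \<epsilon> :: real assume i: "i \<in> I" and \<epsilon>: "0 < \<epsilon>"
  have \<phi>_nonneg: "0 \<le> \<phi> i w e" and \<phi>_0: "\<phi> i w 0 = 0" if "w \<in> space M" for w e
    using born i that unfolding integral_bornology_def by auto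
  let ?g = "quotient_integrand f xs x0"
  have g: "measurable_integrand M (?g r)" for r by (rule measurable_integrand_quotient[OF f x0 xs])
  have g_0: "AE w in M. ?g r w 0 \<le> 0" for r
    using a(2) by eventually_elim (simp add: quotient_integrand_def)
  define \<beta> where "\<beta> r = (SUP k\<in>deficits M (?g r) (\<phi> i) \<epsilon>. \<integral>\<^sup>+w. k w \<partial>M)" for r
  have small: "\<forall>\<^sub>F r in at_right 0. \<beta> r \<le> ennreal \<delta>" if \<delta>: "0 < \<delta>" for \<delta>
  proof -
    define B where "B = {x\<in>X. integral_functional M (\<phi> i) x \<le> ereal 1}"
    have "B \<in> \<B>" using born i unfolding integral_bornology_def B_def by blast
    then have "0 \<le> Liminf (at_right 0) (\<lambda>r. INF x\<in>B.
        quotient_functional (integral_functional M f) x0 x r - ereal (pairing M xs x))"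
      using sub unfolding subderivative_def by blast
    moreover have "ereal (- min \<delta> \<epsilon>) < 0" using \<delta> \<epsilon> by auto
    ultimately have "\<forall>\<^sub>F r in at_right 0. ereal (- min \<delta> \<epsilon>) < (INF x\<in>B.
        quotient_functional (integral_functional M f) x0 x r - ereal (pairing M xs x))"
      unfolding le_Liminf_iff by blast
    moreover have "\<forall>\<^sub>F r :: real in at_right 0. 0 < r" by (rule eventually_at_right_less)
    ultimately show ?thesis
    proof eventually_elim
      case (elim r)
      have lower: "- min \<delta> \<epsilon> < integral\<^sup>L M v"
        if x: "x \<in> X" "integral_functional M (\<phi> i) x \<le> 1"
          and v: "integrable M v" "AE w in M. ?g r w (x w) \<le> ereal (v w)" for x v
      proof -
        have "x \<in> B" using x by (simp add: B_def one_ereal_def)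
        have "ereal (- min \<delta> \<epsilon>) < (INF x\<in>B.
          quotient_functional (integral_functional M f) x0 x r - ereal (pairing M xs x))" by (rule elim(1))
        also have "\<dots> \<le> quotient_functional (integral_functional M f) x0 x r - ereal (pairing M xs x)"
          using \<open>x \<in> B\<close> by (rule INF_lower)
        also have "\<dots> = integral_functional M (?g r) x"
          by (rule integral_functional_quotient_integrand[OF a b[OF x(1)] elim(2), symmetric])
        also have "\<dots> \<le> ereal (integral\<^sup>L M v)"
          unfolding integral_functional_def by (rule upper_integral_le[OF v])
        finally show ?thesis by simp
      qed
      show ?case
        unfolding \<beta>_def
        by (intro SUP_least deficits_nn_integral_le[OF M g \<phi>[OF i] \<phi>_nonneg \<phi>_0 g_0 \<epsilon> \<delta> \<Omega> X lower])
    qed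
  qed
  have "\<exists>u :: 'w \<Rightarrow> real. (\<forall>w. 0 \<le> u w) \<and> (\<beta> r < \<infinity> \<longrightarrow> integrable M u \<and> ennreal (integral\<^sup>L M u) \<le> \<beta> r \<and>
      integrand_ge M (?g r) (\<lambda>w e. - ereal \<epsilon> * \<phi> i w e - ereal (u w)))" for r
  proof (cases "\<beta> r < \<infinity>")
    case True
    then show ?thesis
      using integrand_ge_of_bounded_deficits[OF M(1) g \<phi>[OF i] \<phi>_nonneg \<epsilon>, of r]
      unfolding \<beta>_def by blast
  next
    case False
    then show ?thesis by (intro exI[of _ "\<lambda>_. 0"]) auto
  qed
  then have "\<exists>u. \<forall>r. (\<forall>w. 0 \<le> u r w) \<and> (\<beta> r < \<infinity> \<longrightarrow> integrable M (u r) \<and>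
      ennreal (integral\<^sup>L M (u r)) \<le> \<beta> r \<and>
      integrand_ge M (?g r) (\<lambda>w e. - ereal \<epsilon> * \<phi> i w e - ereal (u r w)))"
    by (intro choice allI)
  then obtain u where u_nonneg: "\<And>r w. 0 \<le> u r w"
    and u: "\<And>r. \<beta> r < \<infinity> \<Longrightarrow> integrable M (u r) \<and> ennreal (integral\<^sup>L M (u r)) \<le> \<beta> r \<and>
      integrand_ge M (?g r) (\<lambda>w e. - ereal \<epsilon> * \<phi> i w e - ereal (u r w))"
    by blast
  have fin: "\<forall>\<^sub>F r in at_right 0. \<beta> r < \<infinity>"
    using small[OF zero_less_one] by eventually_elim (simp add: order_le_less_trans)
  have "((\<lambda>r. LINT w|M. \<bar>u r w\<bar>) \<longlongrightarrow> 0) (at_right 0)"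
  proof (rule tendstoI)
    fix \<delta> :: real assume \<delta>: "0 < \<delta>"
    then have "0 < \<delta> / 2" by simp
    from small[OF this] fin show "\<forall>\<^sub>F r in at_right 0. dist (LINT w|M. \<bar>u r w\<bar>) 0 < \<delta>"
    proof eventually_elim
      case (elim r)
      have "ennreal (integral\<^sup>L M (u r)) \<le> ennreal (\<delta> / 2)" using u[OF elim(2)] elim(1) by (blast intro: order_trans)
      then have "integral\<^sup>L M (u r) \<le> \<delta> / 2" using \<delta> by (simp add: ennreal_le_iff)
      moreover have "0 \<le> integral\<^sup>L M (u r)" using u_nonneg by (simp add: integral_nonneg_AE)
      ultimately show ?case using u_nonneg \<delta> by simp
    qed
  qed
  moreover have "\<forall>\<^sub>F r in at_right 0. integrable M (u r)"
    using fin by eventually_elim (use u in blast)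
  moreover have "\<forall>\<^sub>F r in at_right 0. integrand_ge M (?g r) (\<lambda>w e. - ereal \<epsilon> * \<phi> i w e - ereal (u r w))"
    using fin by eventually_elim (use u in blast)
  ultimately show "\<exists>u. (\<forall>r\<in>{0<..<1}. \<forall>w\<in>space M. 0 \<le> u r w) \<and>
      (\<forall>\<^sub>F r in at_right 0. integrable M (u r)) \<and>
      ((\<lambda>r. LINT w|M. \<bar>u r w\<bar>) \<longlongrightarrow> 0) (at_right 0) \<and>
      (\<forall>\<^sub>F r in at_right 0. integrand_ge M (?g r) (\<lambda>w e. - ereal \<epsilon> * \<phi> i w e - ereal (u r w)))"
    using u_nonneg by (intro exI[of _ u]) blast
qed

theorem theorem9p4:
  fixes M :: "'w measure"
    and X :: "('w \<Rightarrow> 'e::{banach, second_countable_topology}) set"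
    and N :: "('w \<Rightarrow> 'e) \<Rightarrow> real"
    and \<Omega> :: "nat \<Rightarrow> 'w set"
    and f :: "'w \<Rightarrow> 'e \<Rightarrow> ereal"
    and I :: "'i set"
    and \<phi> :: "'i \<Rightarrow> 'w \<Rightarrow> 'e \<Rightarrow> ereal"
    and \<B> :: "('w \<Rightarrow> 'e) set set"
    and x0 :: "'w \<Rightarrow> 'e"
    and xs :: "'w \<Rightarrow> ('e \<Rightarrow>\<^sub>L real)"
  assumes "sigma_finite_measure M" and "complete_measure M"
    and "normed_subspace_L0 M X N" and "decomposable M X"
    and "\<And>n. \<Omega> n \<in> sets M" and "incseq \<Omega>" and "(\<Union>n. \<Omega> n) = space M"
    and "\<And>n y. y \<in> Linfty M \<Longrightarrow> (\<lambda>w. indicator (\<Omega> n) w *\<^sub>R y w) \<in> X"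
    and "measurable_integrand M f"
    and "integral_bornology M X I \<phi> \<B>"
    and "x0 \<in> X" and "\<bar>integral_functional M f x0\<bar> \<noteq> \<infinity>"
    and "dual_L0 M X N xs"
  shows "(integrand_minorization M I \<phi> f xs x0 \<longrightarrow>
            subderivative X N \<B> (integral_functional M f) x0 (pairing M xs))
       \<and> (atomless M \<and> (\<forall>i\<in>I. measurable_integrand M (\<phi> i)) \<longrightarrow>
            (subderivative X N \<B> (integral_functional M f) x0 (pairing M xs)
              \<longleftrightarrow> integrand_minorization M I \<phi> f xs x0))"
proof -
  have x0: "x0 \<in> borel_measurable M"
    using assms(3,11) unfolding normed_subspace_L0_def by blast
  have xs: "\<And>e. (\<lambda>w. blinfun_apply (xs w) e) \<in> borel_measurable M"
    and b: "\<And>x. x \<in> X \<Longrightarrow> integrable M (\<lambda>w. blinfun_apply (xs w) (x w))"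
    and dual: "in_dual X N (pairing M xs)"
    using assms(13) unfolding dual_L0_def by auto
  obtain a where a: "integrable M a" "AE w in M. f w (x0 w) = ereal (a w)"
    "integral_functional M f x0 = ereal (integral\<^sup>L M a)"
    using finite_upper_integral_imp_integrable[OF assms(1) measurable_integrand_compose[OF assms(9) x0]
        assms(12)[unfolded integral_functional_def]]
    unfolding integral_functional_def by blast
  have "subderivative X N \<B> (integral_functional M f) x0 (pairing M xs)"
    if "integrand_minorization M I \<phi> f xs x0"
    by (rule subderivative_if_integrand_minorization[OF assms(10) dual b a that])
  moreover have "integrand_minorization M I \<phi> f xs x0"
    if "atomless M" "\<forall>i\<in>I. measurable_integrand M (\<phi> i)"
      "subderivative X N \<B> (integral_functional M f) x0 (pairing M xs)"
    by (rule integrand_minorization_if_subderivative[OF assms(1) that(1) assms(5-9) _ assms(10) x0 xs b a that(3)])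
      (use that(2) in auto)
  ultimately show ?thesis by blast
qed

end
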